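(* Let $N\ge1$, $A=(a_1,\dots,a_N)\in\mathbb{R}^N$ with $a_1<\dots<a_N$, and $T>0$. For $P,Q\in\mathbb{R}^N$ let $\Lambda'$ be the functional defined in the context. 1. Let $P,Q\in\mathbb{R}^N$ and let $\mathcal{Z}=(z_1(t),\dots,z_N(t))_{t\in[0,T]}$ be a global minimizer of $\Lambda'$. Suppose there exist two times $0\le t_1<t_2\le T$ such that $$z_1(t_1)=\dots=z_N(t_1)\quad\text{and}\quad z_1(t_2)=\dots=z_N(t_2).$$ Then for all $t\in[t_1,t_2]$, $z_1(t)=\dots=z_N(t)$. 2. Let $\mathcal{U}$ be the set of pairs $(P,Q)\in\mathbb{R}^N\times\mathbb{R}^N$ such that, for every global minimizer $\mathcal{Z}=(z_1(t),\dots,z_N(t))$ of $\Lambda'$ (with endpoints $P,Q$), the set of times $$\{t\in[0,T]\;|\;z_1(t)=\dots=z_N(t)\}$$ is a non-trivial interval. Then $\mathcal{U}$ is a neighbourhood of $$\{(P,Q)\in\mathbb{R}^N\times\mathbb{R}^N\;|\;p_1=\dots=p_N\text{ and }q_1=\dots=q_N\},$$ where $P=(p_1,\dots,p_N)$ and $Q=(q_1,\dots,q_N)$.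
   Context: For $X=(x_1,\dots,x_N)\in\mathbb{R}^N$ and a permutation $\sigma\in\mathfrak{S}_N$, $X^\sigma:=(x_{\sigma(1)},\dots,x_{\sigma(N)})$. Let $f(X):=\max_{\sigma\in\mathfrak{S}_N}X\cdot A^\sigma$ for $X\in\mathbb{R}^N$ (a convex function), and let $\overline{\nabla} f(X)$ be its extended gradient, i.e. the element of minimal Euclidean norm of the subdifferential $\partial f(X)$. Given $P,Q\in\mathbb{R}^N$, the functional $\Lambda'$ is defined on curves $\mathcal{Z}=(Z_t)_{t\in[0,T]}\in C^0([0,T];\mathbb{R}^N)$ by $$\Lambda'(\mathcal{Z})=\int_0^T\left\{|\dot Z_t|^2+|Z_t-\overline{\nabla} f(Z_t)|^2\right\}dt$$ if $\mathcal{Z}\in H^1([0,T];\mathbb{R}^N)$, $Z_0\in\{P^\sigma:\sigma\in\mathfrak{S}_N\}$ and $Z_T\in\{Q^\sigma:\sigma\in\mathfrak{S}_N\}$, and $\Lambda'(\mathcal{Z})=+\infty$ otherwise. A non-trivial interval is an interval of positive length; a neighbourhood of a set $S$ is a set containing an open set that contains $S$. *)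

theory Defs
  imports "HOL-Analysis.Analysis" "HOL-Combinatorics.Permutations"
begin

text \<open>Vectors of length \<open>N\<close> are elements of \<^typ>\<open>real ^ 'n\<close> for a finite, linearly ordered
  index type; the order on the index type gives meaning to \<open>a\<^sub>1 < \<dots> < a\<^sub>N\<close>.\<close>

definition permute_vec :: "('n::finite \<Rightarrow> 'n) \<Rightarrow> real ^ 'n \<Rightarrow> real ^ 'n"
  where "permute_vec \<sigma> X = (\<chi> i. X $ \<sigma> i)"

definition perm_orbit :: "real ^ 'n::finite \<Rightarrow> (real ^ 'n) set"
  where "perm_orbit X = {permute_vec \<sigma> X | \<sigma>. \<sigma> permutes UNIV}"

definition max_corr :: "real ^ 'n::finite \<Rightarrow> real ^ 'n \<Rightarrow> real"
  where "max_corr A X = Max {X \<bullet> permute_vec \<sigma> A | \<sigma>. \<sigma> permutes UNIV}"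

definition subdifferential :: "('a::real_inner \<Rightarrow> real) \<Rightarrow> 'a \<Rightarrow> 'a set"
  where "subdifferential f x = {v. \<forall>y. f x + v \<bullet> (y - x) \<le> f y}"

text \<open>The minimiser is unique whenever the subdifferential is nonempty, closed and convex, in
  particular for a finite convex function on a Euclidean space.\<close>

definition ext_gradient :: "('a::real_inner \<Rightarrow> real) \<Rightarrow> 'a \<Rightarrow> 'a"
  where "ext_gradient f x =
    (THE v. v \<in> subdifferential f x \<and> (\<forall>w\<in>subdifferential f x. norm v \<le> norm w))"

text \<open>\<open>H\<^sup>1([0,T])\<close> as the space of primitives of square-integrable functions. The function \<open>g\<close> is the
  derivative of \<open>Z\<close>; it is determined up to a null subset of \<open>[0,T]\<close>, so the choice made by
  \<open>h1_deriv\<close> affects no integral.\<close>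

definition has_h1_deriv :: "real \<Rightarrow> (real \<Rightarrow> 'a::euclidean_space) \<Rightarrow> (real \<Rightarrow> 'a) \<Rightarrow> bool"
  where "has_h1_deriv T Z g \<longleftrightarrow>
    set_borel_measurable lborel {0..T} g \<and>
    set_integrable lborel {0..T} (\<lambda>t. (norm (g t))\<^sup>2) \<and>
    (\<forall>t\<in>{0..T}. Z t = Z 0 + (LINT s:{0..t}|lborel. g s))"

definition in_h1 :: "real \<Rightarrow> (real \<Rightarrow> 'a::euclidean_space) \<Rightarrow> bool"
  where "in_h1 T Z \<longleftrightarrow> (\<exists>g. has_h1_deriv T Z g)"

definition h1_deriv :: "real \<Rightarrow> (real \<Rightarrow> 'a::euclidean_space) \<Rightarrow> real \<Rightarrow> 'a"
  where "h1_deriv T Z = (SOME g. has_h1_deriv T Z g)"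

definition Lambda' ::
  "real ^ 'n::finite \<Rightarrow> real \<Rightarrow> real ^ 'n \<Rightarrow> real ^ 'n \<Rightarrow> (real \<Rightarrow> real ^ 'n) \<Rightarrow> ennreal"
  where "Lambda' A T P Q Z =
    (if in_h1 T Z \<and> Z 0 \<in> perm_orbit P \<and> Z T \<in> perm_orbit Q
     then \<integral>\<^sup>+ t\<in>{0..T}. ennreal ((norm (h1_deriv T Z t))\<^sup>2
            + (norm (Z t - ext_gradient (max_corr A) (Z t)))\<^sup>2) \<partial>lborel
     else \<infinity>)"

text \<open>Curves in \<open>C\<^sup>0([0,T])\<close> are functions on \<^typ>\<open>real\<close> continuous on \<open>[0,T]\<close>; nothing below depends
  on their values outside \<open>[0,T]\<close>.\<close>

definition global_minimizer ::
  "real ^ 'n::finite \<Rightarrow> real \<Rightarrow> real ^ 'n \<Rightarrow> real ^ 'n \<Rightarrow> (real \<Rightarrow> real ^ 'n) \<Rightarrow> bool"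
  where "global_minimizer A T P Q Z \<longleftrightarrow> is_arg_min (Lambda' A T P Q) (continuous_on {0..T}) Z"

definition all_equal :: "real ^ 'n::finite \<Rightarrow> bool"
  where "all_equal X \<longleftrightarrow> (\<forall>i j. X $ i = X $ j)"

definition nontrivial_interval :: "real set \<Rightarrow> bool"
  where "nontrivial_interval S \<longleftrightarrow> is_interval S \<and> (\<exists>s\<in>S. \<exists>t\<in>S. s < t)"

definition neighbourhood_of :: "'a::topological_space set \<Rightarrow> 'a set \<Rightarrow> bool"
  where "neighbourhood_of U S \<longleftrightarrow> (\<exists>W. open W \<and> S \<subseteq> W \<and> W \<subseteq> U)"

end

theory Submission
  imports Defs
begin

text \<open>
  Write \<open>G\<close> for the extended gradient of \<open>f = max_corr A\<close>, and split every vector orthogonally into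
  its mean times the all-ones vector and its deviation \<open>dev\<close>; collapse of the particles means
  \<open>dev (Z t) = 0\<close>. Shifting \<open>X\<close> along the diagonal leaves \<open>G X\<close> unchanged, and the mean of \<open>G X\<close> is
  always the mean of \<open>A\<close>. Hence the integrand of the functional is the sum of a term in the mean of
  \<open>Z\<close> and a term \<open>dev_cost\<close> in its deviation, and the deviation of a minimiser minimises the
  integral of \<open>dev_cost\<close> on its own (\<open>dev_energy_minimal\<close>): a competitor may keep the mean and replace
  the deviation.

  The deviation of \<open>G X\<close> vanishes when \<open>X\<close> is diagonal, so resting on the diagonal has deviation
  cost zero. If a minimiser is collapsed at two times, the competitor that stays collapsed in
  between pays nothing there; so the minimiser has to pay nothing either, its deviation has zero
  derivative there, and it remains zero. This is the first claim.

  Off the diagonal the deviation of \<open>G X\<close> is nonzero. Because \<open>f\<close> is a maximum of finitely many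
  linear functions, \<open>G\<close> takes only finitely many values, so this deviation has norm at least some
  \<open>c > 0\<close> and at most some \<open>K\<close> (\<open>dev_ext_gradient_bounds\<close>). If both endpoints are within \<open>e\<close> of the
  diagonal, moving to the diagonal linearly during time \<open>e\<close>, resting, and leaving linearly during
  the last time \<open>e\<close> has deviation energy \<open>O(e)\<close> (\<open>cheap_collapse\<close>). A minimiser then has small
  energy, hence uniformly small deviation (\<open>h1_displacement_le\<close>), and where it is not collapsed it
  pays at rate at least \<open>(c / 2)\<^sup>2\<close>. For small \<open>e\<close> it therefore cannot avoid collapse throughout
  any third of \<open>[0,T]\<close>. Collapse in the first and in the last third, together with the first
  claim, gives the nontrivial interval.
\<close>

section \<open>Subgradients of the maximal correlation\<close>

definition maximizers :: "real ^ 'n::finite \<Rightarrow> real ^ 'n \<Rightarrow> ('n \<Rightarrow> 'n) set"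
  where "maximizers A X = {\<sigma>. \<sigma> permutes UNIV \<and> X \<bullet> permute_vec \<sigma> A = max_corr A X}"

lemma permute_vec_nth [simp]: "permute_vec \<sigma> X $ i = X $ \<sigma> i"
  by (simp add: permute_vec_def)

lemma sum_permute_vec:
  assumes "\<sigma> permutes UNIV"
  shows "(\<Sum>i\<in>UNIV. f (permute_vec \<sigma> X $ i)) = (\<Sum>i\<in>UNIV. f (X $ i))"
  using sum.permute[OF assms, of "\<lambda>i. f (X $ i)"] by (simp add: o_def)

lemma max_corr_image:
  "max_corr A X = Max ((\<lambda>\<sigma>. X \<bullet> permute_vec \<sigma> A) ` {\<sigma>. \<sigma> permutes UNIV})"
  by (auto simp: max_corr_def intro!: arg_cong[where f = Max])

lemma max_corr_ge: "\<sigma> permutes UNIV \<Longrightarrow> X \<bullet> permute_vec \<sigma> A \<le> max_corr A X"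
  unfolding max_corr_image by (intro Max_ge) auto

lemma maximizers_nonempty: "\<exists>\<sigma>. \<sigma> \<in> maximizers A X"
proof -
  have "max_corr A X \<in> (\<lambda>\<sigma>. X \<bullet> permute_vec \<sigma> A) ` {\<sigma>. \<sigma> permutes UNIV}"
    unfolding max_corr_image by (intro Max_in) (auto intro: exI[of _ id] permutes_id)
  then show ?thesis by (auto simp: maximizers_def)
qed

lemma max_corr_leI:
  assumes "\<And>\<sigma>. \<sigma> permutes UNIV \<Longrightarrow> X \<bullet> permute_vec \<sigma> A \<le> c"
  shows "max_corr A X \<le> c"
  using maximizers_nonempty[of A X] assms by (force simp: maximizers_def)

lemma max_corr_0 [simp]: "max_corr A 0 = 0"
  using maximizers_nonempty[of A 0] by (auto simp: maximizers_def)

lemma max_corr_double: "max_corr A (2 *\<^sub>R X) \<le> 2 * max_corr A X"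
  by (rule max_corr_leI) (simp add: max_corr_ge)

lemma inner_vec: "vec c \<bullet> (X :: real ^ 'n::finite) = c * (\<Sum>i\<in>UNIV. X $ i)"
  by (simp add: inner_vec_def sum_distrib_left)

lemma max_corr_add_vec: "max_corr A (X + vec c) = max_corr A X + c * (\<Sum>i\<in>UNIV. A $ i)"
proof -
  have le: "max_corr A (Y + vec d) \<le> max_corr A Y + d * (\<Sum>i\<in>UNIV. A $ i)" for Y d
    by (rule max_corr_leI)
      (simp add: inner_add_left inner_vec sum_permute_vec[where f = "\<lambda>x. x", simplified] max_corr_ge)
  have "X + vec c + vec (- c) = X" by (simp add: vec_eq_iff)
  then have "max_corr A (X + vec c + vec (- c)) = max_corr A X" by (simp only:)
  then show ?thesis
    using le[of X c] le[of "X + vec c" "- c"] by simp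
qed

lemma maximizer_in_subdifferential:
  assumes "\<sigma> \<in> maximizers A X"
  shows "permute_vec \<sigma> A \<in> subdifferential (max_corr A) X"
  using assms max_corr_ge[of \<sigma> _ A]
  by (auto simp: maximizers_def subdifferential_def inner_diff_right inner_commute)

text \<open>Positive homogeneity: testing the subgradient inequality at \<open>0\<close> and at \<open>2 X\<close> forces equality at
  \<open>X\<close>.\<close>

lemma subdifferential_max_corr_iff:
  "v \<in> subdifferential (max_corr A) X \<longleftrightarrow>
    v \<bullet> X = max_corr A X \<and> (\<forall>Y. v \<bullet> Y \<le> max_corr A Y)"
proof
  assume v: "v \<in> subdifferential (max_corr A) X"
  have sub: "max_corr A X + v \<bullet> (Y - X) \<le> max_corr A Y" for Y
    using v by (simp add: subdifferential_def)
  have "v \<bullet> X = max_corr A X"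
    using sub[of 0] sub[of "2 *\<^sub>R X"] max_corr_double[of A X]
    by (simp add: inner_diff_right)
  then show "v \<bullet> X = max_corr A X \<and> (\<forall>Y. v \<bullet> Y \<le> max_corr A Y)"
    using sub by (simp add: inner_diff_right)
qed (simp add: subdifferential_def inner_diff_right)

text \<open>Along the diagonal \<open>max_corr A\<close> is linear, so every subgradient has the same component in that
  direction.\<close>

lemma sum_subgradient:
  assumes v: "v \<in> subdifferential (max_corr A) X"
  shows "(\<Sum>i\<in>UNIV. v $ i) = (\<Sum>i\<in>UNIV. A $ i)"
proof -
  have "v \<bullet> vec c \<le> c * (\<Sum>i\<in>UNIV. A $ i)" for c
    using v max_corr_add_vec[of A 0 c] unfolding subdifferential_max_corr_iff
    by (metis add_0 max_corr_0)
  then have "c * (\<Sum>i\<in>UNIV. v $ i) \<le> c * (\<Sum>i\<in>UNIV. A $ i)" for c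
    by (simp add: inner_vec inner_commute[of v])
  from this[of 1] this[of "- 1"] show ?thesis by simp
qed

text \<open>This makes the subdifferential a function of the set of maximising permutations, of which there
  are finitely many. The test point is \<open>X - s Y\<close> for small \<open>s > 0\<close>: there the maximum is still
  attained only on \<open>maximizers A X\<close>, where it equals \<open>f X - s f Y\<close>; the subgradient inequality at
  this point is the bound \<open>f Y \<le> v \<bullet> Y\<close>.\<close>

lemma subdifferential_mono_maximizers:
  assumes sub: "maximizers A X \<subseteq> maximizers A Y"
  shows "subdifferential (max_corr A) X \<subseteq> subdifferential (max_corr A) Y"
proof
  fix v assume v: "v \<in> subdifferential (max_corr A) X"
  have ev: "\<forall>\<^sub>F s in at_right 0. (X - s *\<^sub>R Y) \<bullet> permute_vec \<sigma> A \<le> max_corr A X - s * max_corr A Y"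
    if \<sigma>: "\<sigma> permutes UNIV" for \<sigma>
  proof (cases "\<sigma> \<in> maximizers A X")
    case True
    with sub have "\<sigma> \<in> maximizers A Y" by auto
    with True show ?thesis by (simp add: maximizers_def inner_diff_left)
  next
    case False
    then have "X \<bullet> permute_vec \<sigma> A < max_corr A X"
      using max_corr_ge[OF \<sigma>, of X A] \<sigma> by (auto simp: maximizers_def)
    moreover have "((\<lambda>s. max_corr A X - s * max_corr A Y - (X - s *\<^sub>R Y) \<bullet> permute_vec \<sigma> A)
        \<longlongrightarrow> max_corr A X - 0 * max_corr A Y - (X - 0 *\<^sub>R Y) \<bullet> permute_vec \<sigma> A) (at_right 0)"
      by (intro tendsto_intros)
    ultimately have "\<forall>\<^sub>F s in at_right 0.
        0 < max_corr A X - s * max_corr A Y - (X - s *\<^sub>R Y) \<bullet> permute_vec \<sigma> A"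
      by (intro order_tendstoD) auto
    then show ?thesis by eventually_elim simp
  qed
  have "\<forall>\<^sub>F s in at_right 0. \<forall>\<sigma>\<in>{\<sigma>. \<sigma> permutes UNIV}.
      (X - s *\<^sub>R Y) \<bullet> permute_vec \<sigma> A \<le> max_corr A X - s * max_corr A Y"
    by (intro eventually_ball_finite) (auto intro: ev)
  with eventually_at_right_less[of "0::real"]
  have "\<forall>\<^sub>F s in at_right 0. 0 < s \<and> max_corr A (X - s *\<^sub>R Y) \<le> max_corr A X - s * max_corr A Y"
    by eventually_elim (auto intro: max_corr_leI)
  then obtain s where s: "0 < s" "max_corr A (X - s *\<^sub>R Y) \<le> max_corr A X - s * max_corr A Y"
    using eventually_happens'[OF trivial_limit_at_right_real] by blast
  have "v \<bullet> (X - s *\<^sub>R Y) \<le> max_corr A X - s * max_corr A Y"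
    using v s(2) unfolding subdifferential_max_corr_iff by (meson order_trans)
  then have "s * max_corr A Y \<le> s * (v \<bullet> Y)"
    using v by (simp add: subdifferential_max_corr_iff inner_diff_right)
  then have "max_corr A Y \<le> v \<bullet> Y"
    using s(1) by simp
  then show "v \<in> subdifferential (max_corr A) Y"
    using v by (auto simp: subdifferential_max_corr_iff intro: antisym)
qed

text \<open>Otherwise swapping the two entries of \<open>A\<close> would increase the correlation.\<close>

lemma maximizer_similarly_ordered:
  assumes "\<sigma> \<in> maximizers A X"
  shows "0 \<le> (X $ i - X $ j) * (A $ \<sigma> i - A $ \<sigma> j)"
proof -
  define b where "b = permute_vec \<sigma> A"
  have \<sigma>: "\<sigma> permutes UNIV" and opt: "X \<bullet> b = max_corr A X"
    using assms by (auto simp: maximizers_def b_def)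
  \<comment> \<open>Compare with the permutation that exchanges the values at \<open>i\<close> and \<open>j\<close>.\<close>
  have "\<sigma> \<circ> Transposition.transpose i j permutes UNIV"
    by (intro permutes_compose permutes_swap_id \<sigma>) auto
  from max_corr_ge[OF this, of X A] opt
  have "X \<bullet> permute_vec (\<sigma> \<circ> Transposition.transpose i j) A \<le> X \<bullet> b" by simp
  moreover have "permute_vec (\<sigma> \<circ> Transposition.transpose i j) A = b + (b $ j - b $ i) *\<^sub>R (axis i 1 - axis j 1)"
    by (auto simp: vec_eq_iff b_def axis_def Transposition.transpose_def)
  ultimately show ?thesis
    by (simp add: inner_add_right inner_diff_right inner_axis b_def algebra_simps)
qed

lemma chebyshev_sum_identity:
  fixes X b :: "real ^ 'n::finite"
  shows "(\<Sum>i\<in>UNIV. \<Sum>j\<in>UNIV. (X $ i - X $ j) * (b $ i - b $ j)) =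
    2 * (real CARD('n) * (X \<bullet> b) - (\<Sum>i\<in>UNIV. X $ i) * (\<Sum>i\<in>UNIV. b $ i))"
proof -
  have "(\<Sum>i\<in>UNIV. \<Sum>j\<in>UNIV. (X $ i - X $ j) * (b $ i - b $ j)) =
      (\<Sum>i\<in>UNIV. \<Sum>j\<in>(UNIV :: 'n set). X $ i * b $ i) + (\<Sum>i\<in>(UNIV :: 'n set). \<Sum>j\<in>UNIV. X $ j * b $ j)
      - (\<Sum>i\<in>UNIV. \<Sum>j\<in>UNIV. X $ i * b $ j) - (\<Sum>i\<in>UNIV. \<Sum>j\<in>UNIV. b $ i * X $ j)"
    unfolding sum.distrib[symmetric] sum_subtractf[symmetric]
    by (intro sum.cong refl) (simp add: algebra_simps)
  then show ?thesis
    unfolding sum_product[symmetric]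
    by (simp add: inner_vec_def sum_distrib_left[symmetric] mult.commute[of "sum (($) b) UNIV"])
qed

text \<open>Chebyshev's sum inequality for the similarly ordered vectors \<open>X\<close> and \<open>A \<circ> \<sigma>\<close>.\<close>

lemma max_corr_ge_mean:
  fixes A X :: "real ^ 'n::finite"
  shows "(\<Sum>i\<in>UNIV. X $ i) * (\<Sum>i\<in>UNIV. A $ i) \<le> real CARD('n) * max_corr A X"
proof -
  obtain \<sigma> where \<sigma>: "\<sigma> \<in> maximizers A X" using maximizers_nonempty by blast
  then have "0 \<le> (\<Sum>i\<in>UNIV. \<Sum>j\<in>UNIV. (X $ i - X $ j) * (permute_vec \<sigma> A $ i - permute_vec \<sigma> A $ j))"
    by (intro sum_nonneg) (simp add: maximizer_similarly_ordered)
  with \<sigma> show ?thesis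
    unfolding chebyshev_sum_identity maximizers_def
    by (simp add: sum_permute_vec[where f = "\<lambda>x. x", simplified])
qed

text \<open>In Chebyshev's identity the term of a pair \<open>i\<close>, \<open>j\<close> with \<open>X $ i \<noteq> X $ j\<close> is strictly positive, because
  the entries of \<open>A\<close> are distinct.\<close>

lemma max_corr_gt_mean:
  fixes A X :: "real ^ 'n::finite"
  assumes inj: "inj (($) A)" and X: "\<not> all_equal X"
  shows "(\<Sum>i\<in>UNIV. X $ i) * (\<Sum>i\<in>UNIV. A $ i) < real CARD('n) * max_corr A X"
proof -
  obtain \<sigma> where \<sigma>: "\<sigma> \<in> maximizers A X" using maximizers_nonempty by blast
  then have perm: "\<sigma> permutes UNIV" by (simp add: maximizers_def)
  obtain i j where ij: "X $ i \<noteq> X $ j" using X by (auto simp: all_equal_def)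
  then have "A $ \<sigma> i \<noteq> A $ \<sigma> j"
    using injD[OF inj] permutes_inj[OF perm] by (metis injD)
  with ij have "0 < (X $ i - X $ j) * (A $ \<sigma> i - A $ \<sigma> j)"
    using maximizer_similarly_ordered[OF \<sigma>, of i j] by (simp add: order_less_le)
  then have "0 < (\<Sum>i\<in>UNIV. \<Sum>j\<in>UNIV. (X $ i - X $ j) * (permute_vec \<sigma> A $ i - permute_vec \<sigma> A $ j))"
    by (intro sum_pos2[where i = i] sum_pos2[where i = j] sum_nonneg)
      (auto simp: maximizer_similarly_ordered[OF \<sigma>])
  with \<sigma> show ?thesis
    unfolding chebyshev_sum_identity maximizers_def
    by (simp add: sum_permute_vec[where f = "\<lambda>x. x", simplified])
qed

section \<open>The extended gradient\<close>

lemma closed_convex_subdifferential: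
  fixes f :: "'a::euclidean_space \<Rightarrow> real"
  shows "closed (subdifferential f x)" "convex (subdifferential f x)"
proof -
  have eq: "subdifferential f x = (\<Inter>y. {v. (y - x) \<bullet> v \<le> f y - f x})"
    by (auto simp: subdifferential_def inner_commute algebra_simps)
  show "closed (subdifferential f x)"
    unfolding eq by (intro closed_INT ballI closed_halfspace_le)
  show "convex (subdifferential f x)"
    unfolding eq by (intro convex_INT convex_halfspace_le)
qed

lemma ext_gradient_eq_closest_point:
  fixes f :: "'a::euclidean_space \<Rightarrow> real"
  assumes ne: "subdifferential f x \<noteq> {}"
  shows "ext_gradient f x = closest_point (subdifferential f x) 0"
  unfolding ext_gradient_def
proof (rule the_equality)
  note cc = closed_convex_subdifferential[of f x]
  show "closest_point (subdifferential f x) 0 \<in> subdifferential f x \<and>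
    (\<forall>w\<in>subdifferential f x. norm (closest_point (subdifferential f x) 0) \<le> norm w)"
    using closest_point_in_set[OF cc(1) ne] closest_point_le[OF cc(1), of _ 0] by auto
  show "v = closest_point (subdifferential f x) 0"
    if "v \<in> subdifferential f x \<and> (\<forall>w\<in>subdifferential f x. norm v \<le> norm w)" for v
    using that cc by (intro closest_point_unique) auto
qed

lemma ext_gradient_in_subdifferential:
  "ext_gradient (max_corr A) X \<in> subdifferential (max_corr A) X"
proof -
  have ne: "subdifferential (max_corr A) X \<noteq> {}"
    using maximizers_nonempty maximizer_in_subdifferential by blast
  show ?thesis
    unfolding ext_gradient_eq_closest_point[OF ne]
    by (rule closest_point_in_set[OF closed_convex_subdifferential(1) ne])
qed

lemma norm_ext_gradient_le:
  assumes "v \<in> subdifferential (max_corr A) X"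
  shows "norm (ext_gradient (max_corr A) X) \<le> norm v"
proof -
  have ne: "subdifferential (max_corr A) X \<noteq> {}" using assms by blast
  show ?thesis
    using closest_point_le[OF closed_convex_subdifferential(1) assms, of 0]
    unfolding ext_gradient_eq_closest_point[OF ne] by simp
qed

lemma ext_gradient_cong_maximizers:
  assumes "maximizers A X = maximizers A Y"
  shows "ext_gradient (max_corr A) X = ext_gradient (max_corr A) Y"
proof -
  have "subdifferential (max_corr A) X = subdifferential (max_corr A) Y"
    using assms by (intro antisym subdifferential_mono_maximizers) auto
  then show ?thesis by (simp add: ext_gradient_def)
qed

text \<open>A shift along the diagonal changes all correlations by the same amount.\<close>

lemma ext_gradient_add_vec:
  "ext_gradient (max_corr A) (X + vec c) = ext_gradient (max_corr A) X"
  by (rule ext_gradient_cong_maximizers)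
    (auto simp: maximizers_def max_corr_add_vec inner_add_left inner_vec
      sum_permute_vec[where f = "\<lambda>x. x", simplified])

lemma ext_gradient_factor:
  obtains h where "\<And>X. ext_gradient (max_corr A) X = h (maximizers A X)"
proof
  show "ext_gradient (max_corr A) X =
    (\<lambda>m. ext_gradient (max_corr A) (SOME Y. maximizers A Y = m)) (maximizers A X)" for X
    by (rule ext_gradient_cong_maximizers) (metis (mono_tags, lifting) someI)
qed

lemma finite_range_ext_gradient: "finite (range (ext_gradient (max_corr A)))"
proof -
  obtain h where h: "\<And>X. ext_gradient (max_corr A) X = h (maximizers A X)"
    using ext_gradient_factor by blast
  have "range (ext_gradient (max_corr A)) \<subseteq> range h" using h by auto
  then show ?thesis by (rule finite_subset) simp
qed

lemma borel_measurable_max_corr [measurable]: "max_corr A \<in> borel_measurable borel"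
proof -
  have "(\<lambda>X. Max ((\<lambda>\<sigma>. X \<bullet> permute_vec \<sigma> A) ` {\<sigma>. \<sigma> permutes UNIV})) \<in> borel_measurable borel"
    by (rule borel_measurable_Max) auto
  then show ?thesis by (simp add: max_corr_image[abs_def])
qed

text \<open>Since the extended gradient is a function of \<open>maximizers A X\<close>, it suffices that \<open>maximizers A\<close> is
  measurable into a finite discrete space; its level sets are cut out by finitely many equations
  between measurable functions and their negations.\<close>

lemma borel_measurable_ext_gradient [measurable]:
  "ext_gradient (max_corr A) \<in> borel_measurable borel"
proof -
  obtain h where h: "\<And>X. ext_gradient (max_corr A) X = h (maximizers A X)"
    using ext_gradient_factor by blast
  have "maximizers A -` {m} \<inter> space borel \<in> sets borel" for m
  proof -
    have "maximizers A X = m \<longleftrightarrow> (\<forall>\<sigma>\<in>UNIV.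
        (\<sigma> permutes UNIV \<and> X \<bullet> permute_vec \<sigma> A = max_corr A X) = (\<sigma> \<in> m))" for X
      by (simp add: maximizers_def set_eq_iff)
    then have "maximizers A -` {m} \<inter> space borel = {X \<in> space borel. \<forall>\<sigma>\<in>UNIV.
        (\<sigma> permutes UNIV \<and> X \<bullet> permute_vec \<sigma> A = max_corr A X) = (\<sigma> \<in> m)}"
      by (simp add: vimage_def)
    also have "\<dots> \<in> sets borel"
      by measurable
    finally show ?thesis .
  qed
  then have [measurable]: "maximizers A \<in> measurable borel (count_space UNIV)"
    by (subst measurable_count_space_eq2) auto
  have "(\<lambda>X. h (maximizers A X)) \<in> borel_measurable borel" by measurable
  then show ?thesis using h by (simp cong: measurable_cong)
qed

section \<open>Mean and deviation\<close>

definition mean :: "real ^ 'n::finite \<Rightarrow> real"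
  where "mean X = (\<Sum>i\<in>UNIV. X $ i) / real CARD('n)"

definition dev :: "real ^ 'n::finite \<Rightarrow> real ^ 'n"
  where "dev X = X - vec (mean X)"

lemma linear_mean: "linear mean"
  by (auto intro!: linearI simp: mean_def sum.distrib sum_distrib_left add_divide_distrib)

lemma linear_dev: "linear dev"
  by (rule linearI)
    (simp_all add: dev_def linear_add[OF linear_mean] linear_cmul[OF linear_mean] vec_eq_iff
      algebra_simps)

lemma mean_vec [simp]: "mean (vec c) = c"
  by (simp add: mean_def)

lemma mean_dev [simp]: "mean (dev X) = 0"
  by (simp add: dev_def linear_diff[OF linear_mean])

lemma dev_dev [simp]: "dev (dev X) = dev X"
  by (simp add: dev_def[of "dev X"] vec_eq_iff)

lemma dev_vec [simp]: "dev (vec c) = 0"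
  by (simp add: dev_def)

lemma dev_eq_0_iff: "dev X = 0 \<longleftrightarrow> all_equal X"
proof
  assume "all_equal X"
  then have "X = vec (X $ undefined)" by (simp add: vec_eq_iff all_equal_def)
  then show "dev X = 0" by (metis dev_vec)
qed (auto simp: dev_def vec_eq_iff all_equal_def)

lemma norm_sq_mean_dev:
  fixes X :: "real ^ 'n::finite"
  shows "(norm X)\<^sup>2 = real CARD('n) * (mean X)\<^sup>2 + (norm (dev X))\<^sup>2"
proof -
  have sum: "(\<Sum>i\<in>UNIV. X $ i) = real CARD('n) * mean X" by (simp add: mean_def)
  have "X \<bullet> vec (mean X) = real CARD('n) * (mean X)\<^sup>2"
    by (simp add: inner_commute[of X "vec (mean X)"] inner_vec sum power2_eq_square)
  then show ?thesis
    unfolding power2_norm_eq_inner dev_def inner_diff_left inner_diff_right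
    by (simp add: inner_vec sum power2_eq_square)
qed

lemma norm_dev_le: "norm (dev X) \<le> norm X"
  by (rule power2_le_imp_le) (simp_all add: norm_sq_mean_dev[of X])

lemma norm_dev_perm_orbit:
  assumes "X \<in> perm_orbit P"
  shows "mean X = mean P" "norm (dev X) = norm (dev P)"
proof -
  obtain \<sigma> where \<sigma>: "\<sigma> permutes UNIV" "X = permute_vec \<sigma> P"
    using assms by (auto simp: perm_orbit_def)
  show m: "mean X = mean P"
    using sum_permute_vec[OF \<sigma>(1), where f = "\<lambda>x. x"] by (simp add: mean_def \<sigma>(2))
  have "(norm X)\<^sup>2 = (norm P)\<^sup>2"
    using sum_permute_vec[OF \<sigma>(1), where f = "\<lambda>x. x * x"]
    by (simp add: power2_norm_eq_inner inner_vec_def \<sigma>(2))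
  then have "(norm (dev X))\<^sup>2 = (norm (dev P))\<^sup>2"
    using m norm_sq_mean_dev[of X] norm_sq_mean_dev[of P] by simp
  then show "norm (dev X) = norm (dev P)" by simp
qed

lemma mean_ext_gradient: "mean (ext_gradient (max_corr A) X) = mean A"
  using sum_subgradient[OF ext_gradient_in_subdifferential] by (simp add: mean_def)

text \<open>The diagonal vector with the mean of \<open>A\<close> is a subgradient by Chebyshev's inequality, and it is the
  shortest one because all subgradients share its mean.\<close>

lemma dev_ext_gradient_all_equal:
  fixes A X :: "real ^ 'n::finite"
  assumes X: "all_equal X"
  shows "dev (ext_gradient (max_corr A) X) = 0"
proof -
  have "X = vec (mean X)" using X by (simp add: dev_eq_0_iff[symmetric] dev_def)
  then have X_eq: "ext_gradient (max_corr A) X = ext_gradient (max_corr A) 0"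
    by (metis ext_gradient_add_vec add_0)
  have "vec (mean A) \<in> subdifferential (max_corr A) 0"
    using max_corr_ge_mean[of _ A]
    by (auto simp: subdifferential_max_corr_iff inner_vec mean_def field_simps)
  then have "norm (ext_gradient (max_corr A) 0) \<le> norm (vec (mean A) :: real ^ 'n)"
    by (rule norm_ext_gradient_le)
  then have "(norm (ext_gradient (max_corr A) 0))\<^sup>2 \<le> (norm (vec (mean A) :: real ^ 'n))\<^sup>2"
    by (intro power_mono) auto
  then show ?thesis
    using norm_sq_mean_dev[of "ext_gradient (max_corr A) 0"]
      norm_sq_mean_dev[of "vec (mean A) :: real ^ 'n"]
    by (simp add: X_eq mean_ext_gradient)
qed

text \<open>A diagonal subgradient at \<open>X\<close> would give equality in Chebyshev's inequality.\<close>

lemma dev_ext_gradient_not_all_equal: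
  fixes A X :: "real ^ 'n::finite"
  assumes inj: "inj (($) A)" and X: "\<not> all_equal X"
  shows "dev (ext_gradient (max_corr A) X) \<noteq> 0"
proof
  let ?v = "ext_gradient (max_corr A) X"
  assume "dev ?v = 0"
  then have v: "?v = vec (mean A)"
    by (simp add: dev_def mean_ext_gradient)
  have "max_corr A X = ?v \<bullet> X"
    using ext_gradient_in_subdifferential[of A X] by (simp add: subdifferential_max_corr_iff)
  also have "\<dots> = mean A * (\<Sum>i\<in>UNIV. X $ i)"
    by (simp add: v inner_vec)
  finally show False
    using max_corr_gt_mean[OF inj X] by (simp add: mean_def algebra_simps)
qed

text \<open>Both bounds are extrema over the finitely many values of the extended gradient.\<close>

lemma dev_ext_gradient_bounds:
  fixes A :: "real ^ 'n::finite"
  assumes inj: "inj (($) A)"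
  obtains c K where "0 < c"
    "\<And>X. \<not> all_equal X \<Longrightarrow> c \<le> norm (dev (ext_gradient (max_corr A) X))"
    "\<And>X. norm (dev (ext_gradient (max_corr A) X)) \<le> K"
proof -
  let ?n = "\<lambda>v :: real ^ 'n. norm (dev v)"
  let ?R = "range (ext_gradient (max_corr A))"
  \<comment> \<open>The element \<open>1\<close> keeps the set nonempty when there is only one coordinate.\<close>
  let ?S = "insert 1 (?n ` (?R - {v. dev v = 0}))"
  have fin: "finite ?R" by (rule finite_range_ext_gradient)
  have "0 < Min ?S" using fin by (subst Min_gr_iff) auto
  moreover have "Min ?S \<le> ?n (ext_gradient (max_corr A) X)" if "\<not> all_equal X" for X
    using fin dev_ext_gradient_not_all_equal[OF inj that] by (intro Min_le) auto
  moreover have "?n (ext_gradient (max_corr A) X) \<le> Max (?n ` ?R)" for X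
    using fin by (intro Max_ge) auto
  ultimately show thesis using that by blast
qed

section \<open>Square-integrable derivatives\<close>

abbreviation lebesgue_upto :: "real \<Rightarrow> real measure"
  where "lebesgue_upto T \<equiv> restrict_space lborel {0..T}"

lemma finite_measure_lebesgue_upto: "finite_measure (lebesgue_upto T)"
  by (rule finite_measureI) (simp add: space_restrict_space emeasure_restrict_space emeasure_lborel_Icc_eq)

lemma lint_upto:
  fixes g :: "real \<Rightarrow> 'a::euclidean_space"
  assumes "t \<le> T"
  shows "(LINT s:{0..t}|lborel. g s) = (LINT s|lebesgue_upto T. indicator {..t} s *\<^sub>R g s)"
  using assms by (auto simp: integral_restrict_space set_lebesgue_integral_def indicator_def
      intro!: Bochner_Integration.integral_cong)

text \<open>On the finite measure \<open>lebesgue_upto T\<close> square-integrability implies integrability, and the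
  indicator of \<open>{..t}\<close> no longer refers to the lower end of the interval.\<close>

lemma has_h1_deriv_iff:
  "has_h1_deriv T Z g \<longleftrightarrow>
    g \<in> borel_measurable (lebesgue_upto T) \<and>
    integrable (lebesgue_upto T) (\<lambda>t. (norm (g t))\<^sup>2) \<and>
    (\<forall>t\<in>{0..T}. Z t = Z 0 + (LINT s|lebesgue_upto T. indicator {..t} s *\<^sub>R g s))"
proof -
  have "(\<forall>t\<in>{0..T}. Z t = Z 0 + (LINT s:{0..t}|lborel. g s)) \<longleftrightarrow>
      (\<forall>t\<in>{0..T}. Z t = Z 0 + (LINT s|lebesgue_upto T. indicator {..t} s *\<^sub>R g s))"
    by (intro ball_cong refl) (simp add: lint_upto[of _ T])
  then show ?thesis
    by (simp add: has_h1_deriv_def borel_measurable_restrict_space_iff set_borel_measurable_def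
        set_integrable_eq)
qed

lemma integrable_of_square_integrable:
  fixes g :: "real \<Rightarrow> 'a::euclidean_space"
  assumes "finite_measure M" "g \<in> borel_measurable M" "integrable M (\<lambda>t. (norm (g t))\<^sup>2)"
  shows "integrable M g"
proof (rule Bochner_Integration.integrable_bound)
  show "integrable M (\<lambda>t. 1 + (norm (g t))\<^sup>2)"
    using assms by (intro Bochner_Integration.integrable_add finite_measure.integrable_const)
  have "x \<le> 1 + x\<^sup>2" for x :: real
  proof -
    have "2 * x \<le> x\<^sup>2 + 1" using zero_le_power2[of "x - 1"] by (simp add: power2_diff)
    moreover have "0 \<le> x\<^sup>2" by simp
    ultimately show ?thesis by linarith
  qed
  then show "AE t in M. norm (g t) \<le> norm (1 + (norm (g t))\<^sup>2)"
    by (intro AE_I2) (simp add: order_trans[OF _ abs_ge_self])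
qed fact

lemma h1_primitive:
  assumes "has_h1_deriv T Z g" "t \<in> {0..T}"
  shows "Z t = Z 0 + (LINT s|lebesgue_upto T. indicator {..t} s *\<^sub>R g s)"
  using assms unfolding has_h1_deriv_iff by blast

lemma integrable_h1_deriv: "has_h1_deriv T Z g \<Longrightarrow> integrable (lebesgue_upto T) g"
  unfolding has_h1_deriv_iff
  using integrable_of_square_integrable finite_measure_lebesgue_upto by blast

lemma integrable_indicator_upto:
  fixes g :: "real \<Rightarrow> 'a::euclidean_space"
  assumes "integrable (lebesgue_upto T) g" "B \<in> sets borel"
  shows "integrable (lebesgue_upto T) (\<lambda>s. indicator B s *\<^sub>R g s)"
proof -
  have "integrable lborel (\<lambda>s. indicator {0..T} s *\<^sub>R g s)"
    using assms(1) by (subst (asm) integrable_restrict_space) auto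
  then have "integrable lborel (\<lambda>s. indicator B s *\<^sub>R (indicator {0..T} s *\<^sub>R g s))"
    using assms(2) by (intro integrable_mult_indicator[where A = B]) auto
  then show ?thesis
    by (subst integrable_restrict_space) (simp_all add: mult.commute)
qed

text \<open>The positive and the negative part of \<open>h\<close> are densities of two finite measures that agree on all
  half-lines, hence everywhere; so the densities agree almost everywhere.\<close>

lemma AE_zero_of_tail_integrals:
  fixes h :: "real \<Rightarrow> real"
  assumes int: "integrable lborel h"
    and zero: "\<And>x. (LINT s|lborel. indicator {x<..} s * h s) = 0"
  shows "AE s in lborel. h s = 0"
proof -
  let ?p = "\<lambda>s. max 0 (h s)" and ?m = "\<lambda>s. max 0 (- h s)"
  have [measurable]: "h \<in> borel_measurable lborel" using int by simp
  have tail: "emeasure (density lborel f) {x<..} = ennreal (LINT s|lborel. indicator {x<..} s * f s)"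
    "integrable lborel (\<lambda>s. indicator {x<..} s * f s)"
    if "integrable lborel f" "\<And>s. 0 \<le> f s" for f :: "real \<Rightarrow> real" and x
  proof -
    have [measurable]: "f \<in> borel_measurable lborel" using that by simp
    show int': "integrable lborel (\<lambda>s. indicator {x<..} s * f s)"
      using integrable_mult_indicator[OF _ that(1), of "{x<..}"] by simp
    have "emeasure (density lborel f) {x<..} = (\<integral>\<^sup>+ s. ennreal (indicator {x<..} s * f s) \<partial>lborel)"
      by (subst emeasure_density) (auto intro!: nn_integral_cong simp: indicator_def)
    also have "\<dots> = ennreal (LINT s|lborel. indicator {x<..} s * f s)"
      using int' that(2) by (intro nn_integral_eq_integral) auto
    finally show "emeasure (density lborel f) {x<..} = ennreal (LINT s|lborel. indicator {x<..} s * f s)" .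
  qed
  have p: "integrable lborel ?p" and m: "integrable lborel ?m"
    using int by (auto intro: integrable_max)
  have "density lborel ?p = density lborel ?m"
  proof (rule measure_eqI_lessThan)
    fix x
    have "(LINT s|lborel. indicator {x<..} s * ?p s) - (LINT s|lborel. indicator {x<..} s * ?m s)
        = (LINT s|lborel. indicator {x<..} s * h s)"
      by (subst Bochner_Integration.integral_diff[OF tail(2)[OF p] tail(2)[OF m], symmetric])
        (auto intro!: Bochner_Integration.integral_cong simp: indicator_def max_def)
    then show "emeasure (density lborel ?p) {x<..} = emeasure (density lborel ?m) {x<..}"
      using zero[of x] tail(1)[OF p] tail(1)[OF m] by simp
    show "emeasure (density lborel ?p) {x<..} < \<infinity>"
      using tail(1)[OF p] by simp
  qed auto
  then have "AE s in lborel. ennreal (?p s) = ennreal (?m s)"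
    by (subst (asm) sigma_finite_measure.density_unique_iff[OF sigma_finite_lborel]) auto
  then show ?thesis
  proof eventually_elim
    fix s assume "ennreal (?p s) = ennreal (?m s)"
    then show "h s = 0" by (auto simp: max_def split: if_splits)
  qed
qed

lemma AE_zero_of_primitive_zero:
  fixes h :: "real \<Rightarrow> 'a::euclidean_space"
  assumes T: "0 \<le> T" and int: "integrable (lebesgue_upto T) h"
    and zero: "\<And>t. t \<in> {0..T} \<Longrightarrow> (LINT s|lebesgue_upto T. indicator {..t} s *\<^sub>R h s) = 0"
  shows "AE s in lebesgue_upto T. h s = 0"
proof -
  have zero': "(LINT s|lebesgue_upto T. indicator {x<..} s *\<^sub>R h s) = 0" for x
  proof -
    have beyond: "(LINT s|lebesgue_upto T. indicator {..t} s *\<^sub>R h s) = (LINT s|lebesgue_upto T. h s)"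
      if "T \<le> t" for t
      using that by (intro Bochner_Integration.integral_cong) (auto simp: space_restrict_space)
    have le: "(LINT s|lebesgue_upto T. indicator {..t} s *\<^sub>R h s) = 0" for t
    proof (cases "t < 0")
      case True
      then show ?thesis
        by (intro integral_eq_zero_AE AE_I2) (auto simp: space_restrict_space)
    next
      case False
      then show ?thesis
        using zero[of t] zero[of T] T beyond[of t] beyond[of T] by (cases "t \<le> T") auto
    qed
    have "(LINT s|lebesgue_upto T. indicator {x<..} s *\<^sub>R h s) =
        (LINT s|lebesgue_upto T. indicator {..max x T} s *\<^sub>R h s - indicator {..x} s *\<^sub>R h s)"
      by (intro Bochner_Integration.integral_cong) (auto simp: space_restrict_space indicator_def)
    also have "\<dots> = 0"
      using le integrable_indicator_upto[OF int] by (subst Bochner_Integration.integral_diff) auto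
    finally show ?thesis .
  qed
  \<comment> \<open>Reduce to real functions, extended by zero outside of \<open>[0,T]\<close>.\<close>
  have "AE s in lebesgue_upto T. \<forall>b\<in>Basis. h s \<bullet> b = 0"
  proof (intro AE_finite_allI finite_Basis)
    fix b :: 'a assume "b \<in> Basis"
    let ?k = "\<lambda>s. indicator {0..T} s * (h s \<bullet> b)"
    have "AE s in lborel. ?k s = 0"
    proof (rule AE_zero_of_tail_integrals)
      have "integrable (lebesgue_upto T) (\<lambda>s. h s \<bullet> b)" using int by (rule integrable_inner_left)
      then show "integrable lborel ?k" by (subst (asm) integrable_restrict_space) auto
      fix x
      have "(LINT s|lborel. indicator {x<..} s * ?k s) =
          (LINT s|lebesgue_upto T. (indicator {x<..} s *\<^sub>R h s) \<bullet> b)"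
        by (subst integral_restrict_space)
          (auto intro!: Bochner_Integration.integral_cong simp: mult_ac)
      also have "\<dots> = (LINT s|lebesgue_upto T. indicator {x<..} s *\<^sub>R h s) \<bullet> b"
        using int by (intro integral_inner_left integrable_indicator_upto) auto
      finally show "(LINT s|lborel. indicator {x<..} s * ?k s) = 0"
        by (simp add: zero')
    qed
    then show "AE s in lebesgue_upto T. h s \<bullet> b = 0"
      by (subst AE_restrict_space_iff) (auto elim!: eventually_mono)
  qed
  then show ?thesis
    by eventually_elim (auto intro: euclidean_eqI)
qed

lemma h1_deriv_unique:
  fixes Z :: "real \<Rightarrow> 'a::euclidean_space"
  assumes T: "0 \<le> T" and g: "has_h1_deriv T Z g" and g': "has_h1_deriv T Z g'"
  shows "AE s in lebesgue_upto T. g s = g' s"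
proof -
  have "AE s in lebesgue_upto T. g s - g' s = 0"
  proof (rule AE_zero_of_primitive_zero[OF T])
    show "integrable (lebesgue_upto T) (\<lambda>s. g s - g' s)"
      using g g' by (intro Bochner_Integration.integrable_diff integrable_h1_deriv)
    fix t assume "t \<in> {0..T}"
    then have "(LINT s|lebesgue_upto T. indicator {..t} s *\<^sub>R g s) =
        (LINT s|lebesgue_upto T. indicator {..t} s *\<^sub>R g' s)"
      using g g' unfolding has_h1_deriv_iff by (metis add_left_cancel)
    then show "(LINT s|lebesgue_upto T. indicator {..t} s *\<^sub>R (g s - g' s)) = 0"
      using integrable_h1_deriv[OF g] integrable_h1_deriv[OF g']
      by (simp add: scaleR_diff_right Bochner_Integration.integral_diff integrable_indicator_upto)
  qed
  then show ?thesis by simp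
qed

lemma AE_h1_deriv:
  assumes "0 \<le> T" "has_h1_deriv T Z g"
  shows "AE s in lebesgue_upto T. h1_deriv T Z s = g s"
  using assms h1_deriv_unique someI[of "has_h1_deriv T Z" g] unfolding h1_deriv_def by blast

lemma has_h1_deriv_linear:
  fixes L :: "'a::euclidean_space \<Rightarrow> 'b::euclidean_space"
  assumes L: "linear L" and g: "has_h1_deriv T Z g"
  shows "has_h1_deriv T (\<lambda>t. L (Z t)) (\<lambda>t. L (g t))"
proof -
  interpret L: bounded_linear L using L by (rule linear_conv_bounded_linear[THEN iffD1])
  obtain B where B: "\<And>x. norm (L x) \<le> norm x * B" using L.bounded by blast
  have gm: "g \<in> borel_measurable (lebesgue_upto T)"
    and g2: "integrable (lebesgue_upto T) (\<lambda>t. (norm (g t))\<^sup>2)"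
    using g by (auto simp: has_h1_deriv_iff)
  have Lg: "(\<lambda>t. L (g t)) \<in> borel_measurable (lebesgue_upto T)"
    using borel_measurable_continuous_on[OF linear_continuous_on[OF L.bounded_linear_axioms] gm] .
  moreover have "integrable (lebesgue_upto T) (\<lambda>t. (norm (L (g t)))\<^sup>2)"
  proof (rule Bochner_Integration.integrable_bound)
    show "integrable (lebesgue_upto T) (\<lambda>t. B\<^sup>2 * (norm (g t))\<^sup>2)" using g2 by simp
    show "AE t in lebesgue_upto T. norm ((norm (L (g t)))\<^sup>2) \<le> norm (B\<^sup>2 * (norm (g t))\<^sup>2)"
      using B by (intro AE_I2) (simp add: power_mult_distrib[symmetric] power_mono mult.commute)
    show "(\<lambda>t. (norm (L (g t)))\<^sup>2) \<in> borel_measurable (lebesgue_upto T)"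
      using Lg by measurable
  qed
  moreover have "L (Z t) = L (Z 0) + (LINT s|lebesgue_upto T. indicator {..t} s *\<^sub>R L (g s))"
    if "t \<in> {0..T}" for t
  proof -
    have "(LINT s|lebesgue_upto T. L (indicator {..t} s *\<^sub>R g s)) =
        L (LINT s|lebesgue_upto T. indicator {..t} s *\<^sub>R g s)"
      using integrable_h1_deriv[OF g]
      by (intro integral_bounded_linear L.bounded_linear_axioms integrable_indicator_upto) auto
    then show ?thesis
      by (simp add: h1_primitive[OF g that] L.scaleR L.add)
  qed
  ultimately show ?thesis unfolding has_h1_deriv_iff by blast
qed

lemma has_h1_deriv_add:
  fixes Z W :: "real \<Rightarrow> 'a::euclidean_space"
  assumes g: "has_h1_deriv T Z g" and h: "has_h1_deriv T W h"
  shows "has_h1_deriv T (\<lambda>t. Z t + W t) (\<lambda>t. g t + h t)"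
proof -
  have [measurable]: "g \<in> borel_measurable (lebesgue_upto T)" "h \<in> borel_measurable (lebesgue_upto T)"
    and g2: "integrable (lebesgue_upto T) (\<lambda>t. (norm (g t))\<^sup>2)"
    and h2: "integrable (lebesgue_upto T) (\<lambda>t. (norm (h t))\<^sup>2)"
    using g h by (auto simp: has_h1_deriv_iff)
  have "integrable (lebesgue_upto T) (\<lambda>t. (norm (g t + h t))\<^sup>2)"
  proof (rule Bochner_Integration.integrable_bound)
    show "integrable (lebesgue_upto T) (\<lambda>t. 2 * (norm (g t))\<^sup>2 + 2 * (norm (h t))\<^sup>2)"
      using g2 h2 by simp
    have "(norm (x + y))\<^sup>2 \<le> 2 * (norm x)\<^sup>2 + 2 * (norm y)\<^sup>2" for x y :: 'a
      using zero_le_power2[of "norm (x - y)"]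
      by (simp add: power2_norm_eq_inner inner_diff_left inner_diff_right inner_add_left
          inner_add_right inner_commute)
    then show "AE t in lebesgue_upto T.
        norm ((norm (g t + h t))\<^sup>2) \<le> norm (2 * (norm (g t))\<^sup>2 + 2 * (norm (h t))\<^sup>2)"
      by (intro AE_I2) simp
  qed measurable
  moreover have "(\<lambda>t. g t + h t) \<in> borel_measurable (lebesgue_upto T)" by measurable
  moreover have "Z t + W t = Z 0 + W 0 +
      (LINT s|lebesgue_upto T. indicator {..t} s *\<^sub>R (g s + h s))" if "t \<in> {0..T}" for t
    using integrable_h1_deriv[OF g] integrable_h1_deriv[OF h]
    by (simp add: h1_primitive[OF g that] h1_primitive[OF h that] scaleR_add_right
        Bochner_Integration.integral_add integrable_indicator_upto)
  ultimately show ?thesis unfolding has_h1_deriv_iff by blast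
qed

lemma has_h1_deriv_const: "has_h1_deriv T (\<lambda>t. c) (\<lambda>t. 0)"
  by (simp add: has_h1_deriv_iff)

lemma has_h1_deriv_ident: "has_h1_deriv T (\<lambda>t. t) (\<lambda>t. 1 :: real)"
proof -
  interpret finite_measure "lebesgue_upto T" by (rule finite_measure_lebesgue_upto)
  have "t = 0 + (LINT s|lebesgue_upto T. indicator {..t} s *\<^sub>R 1)" if "t \<in> {0..T}" for t :: real
  proof -
    have "(LINT s:{0..t}|lborel. 1 :: real) = t"
      using that by (simp add: set_lebesgue_integral_def)
    then show ?thesis
      using lint_upto[of t T "\<lambda>_. 1 :: real"] that by (simp only: atLeastAtMost_iff add_0)
  qed
  then show ?thesis
    unfolding has_h1_deriv_iff by (intro conjI ballI) simp_all
qed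

text \<open>Stopping a curve outside of \<open>[a, b]\<close>. Both competitors below are linear combinations of such
  stopped curves, so no separate gluing of pieces is needed. The half-open interval makes
  \<open>{..a}\<close> and \<open>{a<..b}\<close> disjoint.\<close>

lemma has_h1_deriv_clamp:
  fixes Z :: "real \<Rightarrow> 'a::euclidean_space"
  assumes g: "has_h1_deriv T Z g" and ab: "0 \<le> a" "a \<le> b" "b \<le> T"
  shows "has_h1_deriv T (\<lambda>t. Z (max a (min b t))) (\<lambda>t. indicator {a<..b} t *\<^sub>R g t)"
proof -
  have gm [measurable]: "g \<in> borel_measurable (lebesgue_upto T)"
    and g2: "integrable (lebesgue_upto T) (\<lambda>t. (norm (g t))\<^sup>2)"
    using g by (auto simp: has_h1_deriv_iff)
  note int = integrable_indicator_upto[OF integrable_h1_deriv[OF g]]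
  have "integrable (lebesgue_upto T) (\<lambda>t. indicator {a<..b} t *\<^sub>R (norm (g t))\<^sup>2)"
    by (intro integrable_indicator_upto g2) auto
  then have "integrable (lebesgue_upto T) (\<lambda>t. (norm (indicator {a<..b} t *\<^sub>R g t))\<^sup>2)"
    by (rule Bochner_Integration.integrable_cong[THEN iffD1, rotated 2]) (auto simp: indicator_def)
  moreover have "Z (max a (min b t)) = Z (max a (min b 0)) +
      (LINT s|lebesgue_upto T. indicator {..t} s *\<^sub>R indicator {a<..b} s *\<^sub>R g s)"
    if t: "t \<in> {0..T}" for t
  proof -
    let ?c = "max a (min b t)"
    have "(LINT s|lebesgue_upto T. indicator {..t} s *\<^sub>R indicator {a<..b} s *\<^sub>R g s) =
        (LINT s|lebesgue_upto T. indicator {..?c} s *\<^sub>R g s - indicator {..a} s *\<^sub>R g s)"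
      using ab t by (intro Bochner_Integration.integral_cong) (auto simp: indicator_def)
    also have "\<dots> = (LINT s|lebesgue_upto T. indicator {..?c} s *\<^sub>R g s) -
        (LINT s|lebesgue_upto T. indicator {..a} s *\<^sub>R g s)"
      by (intro Bochner_Integration.integral_diff int) auto
    also have "\<dots> = Z ?c - Z a"
    proof -
      have "?c \<in> {0..T}" "a \<in> {0..T}" using ab t by auto
      from this[THEN h1_primitive[OF g]] show ?thesis by (metis add_diff_cancel_left)
    qed
    finally show ?thesis using ab by (simp add: max_def)
  qed
  moreover have "(\<lambda>t. indicator {a<..b} t *\<^sub>R g t) \<in> borel_measurable (lebesgue_upto T)"
    using int[of "{a<..b}"] by simp
  ultimately show ?thesis unfolding has_h1_deriv_iff by blast
qed

section \<open>Decoupling the mean from the deviation\<close>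

text \<open>The integrand of the functional at a point \<open>X\<close> with velocity \<open>x\<close>.\<close>

definition cost :: "real ^ 'n::finite \<Rightarrow> real ^ 'n \<Rightarrow> real ^ 'n \<Rightarrow> real"
  where "cost A X x = (norm x)\<^sup>2 + (norm (X - ext_gradient (max_corr A) X))\<^sup>2"

definition dev_cost :: "real ^ 'n::finite \<Rightarrow> real ^ 'n \<Rightarrow> real ^ 'n \<Rightarrow> real"
  where "dev_cost A X x = (norm (dev x))\<^sup>2 + (norm (dev (X - ext_gradient (max_corr A) X)))\<^sup>2"

lemma ext_gradient_dev: "ext_gradient (max_corr A) (dev X) = ext_gradient (max_corr A) X"
  using ext_gradient_add_vec[of A "dev X" "mean X"] by (simp add: dev_def)

text \<open>The orthogonal splitting of the integrand: the remainder depends on \<open>X\<close> and \<open>x\<close> only through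
  their means.\<close>

lemma cost_eq_dev_cost:
  fixes A :: "real ^ 'n::finite"
  shows "cost A X x = dev_cost A X x + real CARD('n) * ((mean x)\<^sup>2 + (mean X - mean A)\<^sup>2)"
  using norm_sq_mean_dev[of x] norm_sq_mean_dev[of "X - ext_gradient (max_corr A) X"]
  by (simp add: cost_def dev_cost_def linear_diff[OF linear_mean] mean_ext_gradient distrib_left)

lemma dev_cost_cong:
  assumes "dev X = dev Y" "dev x = dev y"
  shows "dev_cost A X x = dev_cost A Y y"
  using assms ext_gradient_dev[of A X] ext_gradient_dev[of A Y]
  by (simp add: dev_cost_def linear_diff[OF linear_dev])

lemma dev_cost_nonneg [simp]: "0 \<le> dev_cost A X x"
  by (simp add: dev_cost_def)

text \<open>Resting on the diagonal is free.\<close>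

lemma dev_cost_rest:
  assumes "dev X = 0" "dev x = 0"
  shows "dev_cost A X x = 0"
  using assms dev_ext_gradient_all_equal[of X A, folded dev_eq_0_iff]
  by (simp add: dev_cost_def linear_diff[OF linear_dev])

lemma square_integrable_gap:
  fixes A :: "real ^ 'n::finite"
  assumes Z: "continuous_on {0..T} Z"
  shows "(\<lambda>t. Z t - ext_gradient (max_corr A) (Z t)) \<in> borel_measurable (lebesgue_upto T)"
    and "integrable (lebesgue_upto T) (\<lambda>t. (norm (Z t - ext_gradient (max_corr A) (Z t)))\<^sup>2)"
proof -
  interpret finite_measure "lebesgue_upto T" by (rule finite_measure_lebesgue_upto)
  have "Z \<in> borel_measurable (restrict_space borel {0..T})"
    using Z by (rule borel_measurable_continuous_on_restrict)
  then have [measurable]: "Z \<in> borel_measurable (lebesgue_upto T)"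
    by (simp cong: measurable_cong_sets add: sets_restrict_space)
  show meas [measurable]:
    "(\<lambda>t. Z t - ext_gradient (max_corr A) (Z t)) \<in> borel_measurable (lebesgue_upto T)"
    by measurable
  have "bounded (Z ` {0..T})"
    using Z by (intro compact_imp_bounded compact_continuous_image) auto
  then obtain B where B: "\<And>t. t \<in> {0..T} \<Longrightarrow> norm (Z t) \<le> B"
    by (metis bounded_iff imageI)
  have "bounded (range (ext_gradient (max_corr A)))"
    by (intro finite_imp_bounded finite_range_ext_gradient)
  then obtain B' where B': "\<And>X. norm (ext_gradient (max_corr A) X) \<le> B'"
    by (auto simp: bounded_iff)
  have "norm ((norm (Z t - ext_gradient (max_corr A) (Z t)))\<^sup>2) \<le> (B + B')\<^sup>2" if "t \<in> {0..T}" for t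
    using norm_triangle_ineq4[of "Z t" "ext_gradient (max_corr A) (Z t)"] B[OF that] B'[of "Z t"]
    by (simp add: power_mono)
  then show "integrable (lebesgue_upto T) (\<lambda>t. (norm (Z t - ext_gradient (max_corr A) (Z t)))\<^sup>2)"
    by (intro integrable_const_bound[where B = "(B + B')\<^sup>2"] AE_I2)
      (auto simp: space_restrict_space)
qed

lemma integrable_cost:
  assumes "has_h1_deriv T Z z" "continuous_on {0..T} Z"
  shows "integrable (lebesgue_upto T) (\<lambda>t. cost A (Z t) (z t))"
  using assms square_integrable_gap[of T Z A] unfolding cost_def has_h1_deriv_iff by simp

lemma square_integrable_dev:
  fixes u :: "real \<Rightarrow> real ^ 'n::finite"
  assumes u [measurable]: "u \<in> borel_measurable M" and u2: "integrable M (\<lambda>t. (norm (u t))\<^sup>2)"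
  shows "integrable M (\<lambda>t. (norm (dev (u t)))\<^sup>2)"
proof (rule Bochner_Integration.integrable_bound[OF u2])
  have [measurable]: "dev \<in> borel_measurable borel"
    by (intro borel_measurable_continuous_onI linear_continuous_on linear_conv_bounded_linear[THEN iffD1]
        linear_dev)
  show "(\<lambda>t. (norm (dev (u t)))\<^sup>2) \<in> borel_measurable M" by measurable
  show "AE t in M. norm ((norm (dev (u t)))\<^sup>2) \<le> norm ((norm (u t))\<^sup>2)"
    by (intro AE_I2) (simp add: power_mono norm_dev_le)
qed

lemma integrable_dev_cost:
  assumes "has_h1_deriv T Z z" "continuous_on {0..T} Z"
  shows "integrable (lebesgue_upto T) (\<lambda>t. dev_cost A (Z t) (z t))"
  using assms square_integrable_gap[of T Z A] unfolding dev_cost_def has_h1_deriv_iff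
  by (intro Bochner_Integration.integrable_add square_integrable_dev) auto

lemma Lambda'_eq_integral_cost:
  assumes T: "0 \<le> T" and z: "has_h1_deriv T Z z" and cont: "continuous_on {0..T} Z"
    and ends: "Z 0 \<in> perm_orbit P" "Z T \<in> perm_orbit Q"
  shows "Lambda' A T P Q Z = ennreal (LINT t|lebesgue_upto T. cost A (Z t) (z t))"
proof -
  have "in_h1 T Z" using z by (auto simp: in_h1_def)
  then have "Lambda' A T P Q Z = (\<integral>\<^sup>+ t\<in>{0..T}. ennreal (cost A (Z t) (h1_deriv T Z t)) \<partial>lborel)"
    using ends by (simp add: Lambda'_def cost_def)
  also have "\<dots> = (\<integral>\<^sup>+ t. ennreal (cost A (Z t) (h1_deriv T Z t)) \<partial>lebesgue_upto T)"
    by (simp add: nn_integral_restrict_space)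
  also have "\<dots> = (\<integral>\<^sup>+ t. ennreal (cost A (Z t) (z t)) \<partial>lebesgue_upto T)"
    using AE_h1_deriv[OF T z] by (intro nn_integral_cong_AE) (auto elim!: eventually_mono)
  also have "\<dots> = ennreal (LINT t|lebesgue_upto T. cost A (Z t) (z t))"
    using integrable_cost[OF z cont] by (intro nn_integral_eq_integral AE_I2) (auto simp: cost_def)
  finally show ?thesis .
qed

lemma perm_orbit_self: "P \<in> perm_orbit P"
proof -
  have "P = permute_vec id P" by (simp add: vec_eq_iff)
  then show ?thesis unfolding perm_orbit_def using permutes_id by blast
qed

text \<open>The boundary conditions hold because a minimiser has finite energy: the straight line from \<open>P\<close> to
  \<open>Q\<close> does.\<close>

lemma global_minimizerD:
  fixes A P Q :: "real ^ 'n::finite"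
  assumes T: "0 < T" and min: "global_minimizer A T P Q Z"
  shows "continuous_on {0..T} Z" "in_h1 T Z" "Z 0 \<in> perm_orbit P" "Z T \<in> perm_orbit Q"
    "\<And>W. continuous_on {0..T} W \<Longrightarrow> Lambda' A T P Q Z \<le> Lambda' A T P Q W"
proof -
  show "continuous_on {0..T} Z"
    and le: "\<And>W. continuous_on {0..T} W \<Longrightarrow> Lambda' A T P Q Z \<le> Lambda' A T P Q W"
    using min by (auto simp: global_minimizer_def is_arg_min_def not_less)
  let ?L = "\<lambda>t. t *\<^sub>R ((1 / T) *\<^sub>R (Q - P)) + P"
  have "has_h1_deriv T ?L (\<lambda>t. 1 *\<^sub>R ((1 / T) *\<^sub>R (Q - P)) + 0)"
    by (rule has_h1_deriv_add[OF has_h1_deriv_linear[OF _ has_h1_deriv_ident] has_h1_deriv_const])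
      (rule linearI, auto simp: scaleR_add_left add_divide_distrib)
  moreover have "continuous_on {0..T} ?L" by (intro continuous_intros)
  moreover have "?L T = Q" using T by simp
  ultimately have "Lambda' A T P Q ?L < \<infinity>"
    using T by (subst Lambda'_eq_integral_cost) (auto simp: perm_orbit_self)
  with le[of ?L] \<open>continuous_on {0..T} ?L\<close> have "Lambda' A T P Q Z < \<infinity>"
    using le_less_trans by blast
  then show "in_h1 T Z" "Z 0 \<in> perm_orbit P" "Z T \<in> perm_orbit Q"
    by (auto simp: Lambda'_def split: if_splits)
qed

definition dev_energy ::
  "real ^ 'n::finite \<Rightarrow> real \<Rightarrow> (real \<Rightarrow> real ^ 'n) \<Rightarrow> (real \<Rightarrow> real ^ 'n) \<Rightarrow> real"
  where "dev_energy A T Z z = (LINT t|lebesgue_upto T. dev_cost A (Z t) (z t))"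

lemma linear_vec_mean: "linear (\<lambda>X. vec (mean X) :: real ^ 'n::finite)"
  by (rule linearI) (simp_all add: linear_add[OF linear_mean] linear_cmul[OF linear_mean] vec_eq_iff)

text \<open>The competitor in the minimality of \<open>Z\<close> has the mean of \<open>Z\<close> and the deviation of \<open>V\<close>. The energies
  of the means cancel, which is legitimate because all the integrals are finite.\<close>

lemma dev_energy_minimal:
  fixes A :: "real ^ 'n::finite"
  assumes T: "0 < T" and min: "global_minimizer A T P Q Z" and z: "has_h1_deriv T Z z"
    and v: "has_h1_deriv T V v" and V: "continuous_on {0..T} V"
    and ends: "dev (V 0) = dev (Z 0)" "dev (V T) = dev (Z T)"
  shows "dev_energy A T Z z \<le> dev_energy A T V v"
proof -
  note Z = global_minimizerD[OF T min]
  let ?W = "\<lambda>t. vec (mean (Z t)) + dev (V t)" and ?w = "\<lambda>t. vec (mean (z t)) + dev (v t)"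
  have w: "has_h1_deriv T ?W ?w"
    by (intro has_h1_deriv_add has_h1_deriv_linear[OF linear_vec_mean z]
        has_h1_deriv_linear[OF linear_dev v])
  have W: "continuous_on {0..T} ?W"
    by (intro continuous_on_add linear_continuous_on_compose[OF Z(1) linear_vec_mean]
        linear_continuous_on_compose[OF V linear_dev])
  have W_ends: "?W 0 = Z 0" "?W T = Z T"
    unfolding ends by (simp_all add: dev_def)
  have split: "cost A (?W t) (?w t) - dev_cost A (V t) (v t) = cost A (Z t) (z t) - dev_cost A (Z t) (z t)" for t
  proof -
    have "dev_cost A (?W t) (?w t) = dev_cost A (V t) (v t)"
      by (rule dev_cost_cong) (simp_all add: linear_add[OF linear_dev])
    then show ?thesis
      unfolding cost_eq_dev_cost by (simp add: linear_add[OF linear_mean])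
  qed
  have "Lambda' A T P Q Z \<le> Lambda' A T P Q ?W" by (rule Z(5)[OF W])
  then have "(LINT t|lebesgue_upto T. cost A (Z t) (z t)) \<le> (LINT t|lebesgue_upto T. cost A (?W t) (?w t))"
    using T Z W_ends
    by (simp add: Lambda'_eq_integral_cost[OF _ z] Lambda'_eq_integral_cost[OF _ w W]
        Bochner_Integration.integral_nonneg cost_def)
  moreover have "(LINT t|lebesgue_upto T. cost A (?W t) (?w t)) - dev_energy A T V v =
      (LINT t|lebesgue_upto T. cost A (Z t) (z t)) - dev_energy A T Z z"
    unfolding dev_energy_def split
      Bochner_Integration.integral_diff[OF integrable_cost[OF w W] integrable_dev_cost[OF v V], symmetric]
      Bochner_Integration.integral_diff[OF integrable_cost[OF z Z(1)] integrable_dev_cost[OF z Z(1)], symmetric]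
    by (rule refl)
  ultimately show ?thesis by simp
qed

section \<open>Two collapse times\<close>

text \<open>The competitor \<open>V = Z - Z \<circ> c + Z t\<^sub>1\<close>, where \<open>c\<close> is the clamping to \<open>[t\<^sub>1, t\<^sub>2]\<close>, has deviation zero on
  this interval and the deviation of \<open>Z\<close> outside, because \<open>dev (Z t\<^sub>1) = dev (Z t\<^sub>2) = 0\<close>.\<close>

lemma all_equal_between:
  fixes A :: "real ^ 'n::finite"
  assumes T: "0 < T" and min: "global_minimizer A T P Q Z"
    and t12: "0 \<le> t\<^sub>1" "t\<^sub>1 < t\<^sub>2" "t\<^sub>2 \<le> T"
    and eq: "all_equal (Z t\<^sub>1)" "all_equal (Z t\<^sub>2)" and t: "t \<in> {t\<^sub>1..t\<^sub>2}"
  shows "all_equal (Z t)"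
proof -
  note Z = global_minimizerD[OF T min]
  obtain z where z: "has_h1_deriv T Z z" using Z(2) by (auto simp: in_h1_def)
  have eq0: "dev (Z t\<^sub>1) = 0" "dev (Z t\<^sub>2) = 0" using eq by (simp_all add: dev_eq_0_iff)
  let ?c = "\<lambda>t. max t\<^sub>1 (min t\<^sub>2 t)" and ?I = "indicator {t\<^sub>1<..t\<^sub>2} :: real \<Rightarrow> real"
  let ?V = "\<lambda>t. Z t + - Z (?c t) + Z t\<^sub>1" and ?v = "\<lambda>t. z t + - (?I t *\<^sub>R z t) + 0"
  have v: "has_h1_deriv T ?V ?v"
    using t12 by (intro has_h1_deriv_add has_h1_deriv_const z has_h1_deriv_linear[where L = uminus]
        has_h1_deriv_clamp linear_uminus) auto
  have "continuous_on {0..T} (\<lambda>t. Z (?c t))"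
    using t12 by (intro continuous_on_compose2[OF Z(1)] continuous_intros) auto
  then have V: "continuous_on {0..T} ?V" by (intro continuous_intros Z(1))
  have dev_V: "dev (?V s) = dev (Z s) - dev (Z (?c s))" for s
    by (simp add: linear_add[OF linear_dev] linear_diff[OF linear_dev] eq0)
  have c_ends: "?c 0 = t\<^sub>1" "?c T = t\<^sub>2" using t12 by auto
  have "dev (?V 0) = dev (Z 0)" "dev (?V T) = dev (Z T)"
    using dev_V[of 0] dev_V[of T] unfolding c_ends eq0 by (simp_all only: diff_zero)
  then have "dev_energy A T Z z \<le> dev_energy A T ?V ?v"
    by (rule dev_energy_minimal[OF T min z v V])
  also have "dev_energy A T ?V ?v =
      (LINT s|lebesgue_upto T. dev_cost A (Z s) (z s) - ?I s *\<^sub>R dev_cost A (Z s) (z s))"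
    unfolding dev_energy_def
  proof (intro Bochner_Integration.integral_cong refl)
    fix s
    show "dev_cost A (?V s) (?v s) = dev_cost A (Z s) (z s) - ?I s *\<^sub>R dev_cost A (Z s) (z s)"
    proof (cases "s \<in> {t\<^sub>1<..t\<^sub>2}")
      case True
      then have c: "?c s = s" by auto
      have "dev_cost A (?V s) (?v s) = 0"
        by (rule dev_cost_rest) (use True c in \<open>simp_all add: linear_0[OF linear_dev] eq0\<close>)
      then show ?thesis using True by simp
    next
      case False
      then have "?c s = t\<^sub>1 \<or> ?c s = t\<^sub>2" by auto
      then have "dev (Z (?c s)) = 0" using eq0 by auto
      then have "dev_cost A (?V s) (?v s) = dev_cost A (Z s) (z s)"
        using False by (intro dev_cost_cong) (simp_all only: dev_V, simp_all)
      then show ?thesis using False by simp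
    qed
  qed
  also have "\<dots> = dev_energy A T Z z - (LINT s|lebesgue_upto T. ?I s *\<^sub>R dev_cost A (Z s) (z s))"
    unfolding dev_energy_def
    by (intro Bochner_Integration.integral_diff integrable_indicator_upto integrable_dev_cost z Z(1)) auto
  finally have le0: "(LINT s|lebesgue_upto T. ?I s *\<^sub>R dev_cost A (Z s) (z s)) \<le> 0" by simp
  have int: "integrable (lebesgue_upto T) (\<lambda>s. ?I s *\<^sub>R dev_cost A (Z s) (z s))"
    by (intro integrable_indicator_upto integrable_dev_cost z Z(1)) auto
  have "0 \<le> (LINT s|lebesgue_upto T. ?I s *\<^sub>R dev_cost A (Z s) (z s))"
    by (intro Bochner_Integration.integral_nonneg) simp
  with le0 have "(LINT s|lebesgue_upto T. ?I s *\<^sub>R dev_cost A (Z s) (z s)) = 0" by (rule antisym)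
  then have "AE s in lebesgue_upto T. ?I s *\<^sub>R dev_cost A (Z s) (z s) = 0"
    by (subst (asm) integral_nonneg_eq_0_iff_AE[OF int]) simp_all
  then have AE0: "AE s in lebesgue_upto T. ?I s *\<^sub>R dev (z s) = 0"
  proof eventually_elim
    case (elim s)
    then have "?I s = 0 \<or> (norm (dev (z s)))\<^sup>2 + (norm (dev (Z s - ext_gradient (max_corr A) (Z s))))\<^sup>2 = 0"
      by (auto simp: dev_cost_def)
    then show ?case
      by (auto simp: add_nonneg_eq_0_iff)
  qed
  have y: "has_h1_deriv T (\<lambda>t. dev (Z (?c t))) (\<lambda>t. ?I t *\<^sub>R dev (z t))"
    using t12 by (intro has_h1_deriv_clamp[OF has_h1_deriv_linear[OF linear_dev z]]) auto
  have c_t: "?c t = t" and "t \<in> {0..T}" using t t12 by auto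
  from h1_primitive[OF y this(2)]
  have "dev (Z t) = dev (Z t\<^sub>1) + (LINT s|lebesgue_upto T. indicator {..t} s *\<^sub>R ?I s *\<^sub>R dev (z s))"
    by (simp only: c_t c_ends)
  moreover have "(LINT s|lebesgue_upto T. indicator {..t} s *\<^sub>R ?I s *\<^sub>R dev (z s)) = 0"
    using AE0 by (intro integral_eq_zero_AE) (auto elim!: eventually_mono)
  ultimately have "dev (Z t) = 0" by (simp only: eq0 add_0)
  then show ?thesis by (simp add: dev_eq_0_iff)
qed

section \<open>Endpoints close to the diagonal\<close>

lemma integral_indicator_upto:
  assumes "0 \<le> a" "a \<le> b" "b \<le> T"
  shows "(LINT s|lebesgue_upto T. indicator {a..b} s :: real) = b - a"
proof -
  have "(LINT s|lebesgue_upto T. indicator {a..b} s :: real) =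
      (LINT s|lborel. indicator {0..T} s *\<^sub>R indicator {a..b} s)"
    by (rule integral_restrict_space) simp
  also have "\<dots> = (LINT s|lborel. indicator {a..b} s)"
    using assms by (intro Bochner_Integration.integral_cong) (auto simp: indicator_def)
  finally show ?thesis using assms by simp
qed

text \<open>Speed and distance to the diagonal are at most \<open>1\<close> in the two phases of motion, each of duration
  \<open>e\<close>, so the deviation cost there is at most \<open>1 + (1 + K)\<^sup>2\<close>; in between it is zero.\<close>

lemma cheap_collapse:
  fixes A X Y :: "real ^ 'n::finite"
  assumes K: "\<And>X. norm (dev (ext_gradient (max_corr A) X)) \<le> K"
    and e: "0 < e" "e \<le> 1" "2 * e < T"
    and X: "norm (dev X) \<le> e" and Y: "norm (dev Y) \<le> e"
  obtains V v where "has_h1_deriv T V v" "continuous_on {0..T} V" "V 0 = dev X" "V T = dev Y"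
    "dev_energy A T V v \<le> 2 * e * (1 + (1 + K)\<^sup>2)"
proof -
  interpret finite_measure "lebesgue_upto T" by (rule finite_measure_lebesgue_upto)
  let ?x = "- (1 / e) *\<^sub>R dev X" and ?y = "(1 / e) *\<^sub>R dev Y"
  let ?c0 = "\<lambda>t. max 0 (min e t)" and ?c1 = "\<lambda>t. max (T - e) (min T t)"
  let ?V = "\<lambda>t. ?c0 t *\<^sub>R ?x + ?c1 t *\<^sub>R ?y + (dev X - (T - e) *\<^sub>R ?y)"
  let ?v = "\<lambda>t. (indicator {0<..e} t *\<^sub>R 1) *\<^sub>R ?x + (indicator {T - e<..T} t *\<^sub>R 1) *\<^sub>R ?y + 0"
  let ?C = "1 + (1 + K)\<^sup>2"
  let ?b = "\<lambda>t. ?C * (indicator {0..e} t + indicator {T - e..T} t) :: real"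
  have lin: "linear (\<lambda>r :: real. r *\<^sub>R u)" for u :: "real ^ 'n"
    by (rule linearI) (auto simp: scaleR_add_left)
  have v: "has_h1_deriv T ?V ?v"
    using e by (intro has_h1_deriv_add has_h1_deriv_const
        has_h1_deriv_linear[OF lin has_h1_deriv_clamp[OF has_h1_deriv_ident]]) auto
  have V: "continuous_on {0..T} ?V" by (intro continuous_intros)
  have norm_xy: "norm (dev ?x) \<le> 1" "norm (dev ?y) \<le> 1"
    using X Y e by (auto simp: linear_cmul[OF linear_dev] linear_neg[OF linear_dev] divide_le_eq)
  have K0: "0 \<le> K" using K[of 0] norm_ge_zero order_trans by blast
  have near: "dev_cost A U u \<le> ?C" if "norm (dev u) \<le> 1" "norm (dev U) \<le> 1" for U u
  proof -
    have "norm (dev (U - ext_gradient (max_corr A) U)) \<le> 1 + K"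
      using that K[of U] norm_triangle_ineq4[of "dev U" "dev (ext_gradient (max_corr A) U)"]
      by (simp add: linear_diff[OF linear_dev])
    then have "(norm (dev (U - ext_gradient (max_corr A) U)))\<^sup>2 \<le> (1 + K)\<^sup>2"
      by (intro power_mono) auto
    moreover have "(norm (dev u))\<^sup>2 \<le> 1" using that by (simp add: power_le_one)
    ultimately show ?thesis by (simp add: dev_cost_def)
  qed
  have le: "dev_cost A (?V t) (?v t) \<le> ?b t" if t: "t \<in> {0..T}" for t
  proof -
    consider "t \<le> e" | "e < t" "t \<le> T - e" | "T - e < t" by linarith
    then show ?thesis
    proof cases
      case 1
      have "?V t = (1 - t / e) *\<^sub>R dev X" using 1 e t by (simp add: scaleR_diff_left)
      then have "dev (?V t) = (1 - t / e) *\<^sub>R dev X" by (simp add: linear_cmul[OF linear_dev])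
      moreover have "norm ((1 - t / e) *\<^sub>R dev X) \<le> 1 * 1"
        unfolding norm_scaleR using 1 e t X by (intro mult_mono) auto
      ultimately have "norm (dev (?V t)) \<le> 1" by simp
      moreover have "norm (dev (?v t)) \<le> 1"
        using 1 e t norm_xy by (auto simp: indicator_def linear_0[OF linear_dev])
      ultimately have "dev_cost A (?V t) (?v t) \<le> ?C" by (intro near)
      also have "\<dots> \<le> ?b t" using 1 e t by (simp add: indicator_def)
      finally show ?thesis .
    next
      case 2
      have "?V t = 0" "?v t = 0" using 2 e t by (simp_all add: algebra_simps)
      then have "dev_cost A (?V t) (?v t) = 0"
        by (intro dev_cost_rest) (simp_all only: linear_0[OF linear_dev])
      also have "0 \<le> ?b t" by simp
      finally show ?thesis .
    next
      case 3
      have "?V t = ((t - (T - e)) / e) *\<^sub>R dev Y"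
        using 3 e t by (simp add: scaleR_diff_left[symmetric] diff_divide_distrib)
      then have "dev (?V t) = ((t - (T - e)) / e) *\<^sub>R dev Y" by (simp add: linear_cmul[OF linear_dev])
      moreover have "norm (((t - (T - e)) / e) *\<^sub>R dev Y) \<le> 1 * 1"
        unfolding norm_scaleR using 3 e t Y by (intro mult_mono) auto
      ultimately have "norm (dev (?V t)) \<le> 1" by simp
      moreover have "norm (dev (?v t)) \<le> 1"
        using 3 e t norm_xy by (auto simp: indicator_def linear_0[OF linear_dev])
      ultimately have "dev_cost A (?V t) (?v t) \<le> ?C" by (intro near)
      also have "\<dots> \<le> ?b t" using 3 e t by (simp add: indicator_def)
      finally show ?thesis .
    qed
  qed
  have ind: "integrable (lebesgue_upto T) (indicator B :: real \<Rightarrow> real)" if "B \<in> sets borel" for B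
    using integrable_indicator_upto[OF integrable_const[of "1::real"] that] by simp
  have "dev_energy A T ?V ?v \<le> (LINT t|lebesgue_upto T. ?b t)"
    unfolding dev_energy_def
    by (intro Bochner_Integration.integral_mono integrable_dev_cost v V)
      (use le ind in \<open>auto simp: space_restrict_space\<close>)
  also have "\<dots> = ?C * ((LINT t|lebesgue_upto T. indicator {0..e} t) +
      (LINT t|lebesgue_upto T. indicator {T - e..T} t))"
    by (subst integral_mult_right_zero, subst Bochner_Integration.integral_add) (auto intro: ind)
  also have "\<dots> = 2 * e * ?C"
    using e integral_indicator_upto[of 0 e T] integral_indicator_upto[of "T - e" T T]
    by (simp only:) simp
  finally have "dev_energy A T ?V ?v \<le> 2 * e * ?C" .
  moreover have "?V 0 = dev X" using e by simp
  moreover have "?V T = dev Y"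
  proof -
    have "T / e - (T - e) / e = 1" using e by (simp add: field_simps)
    then show ?thesis using e by (simp add: scaleR_diff_left[symmetric])
  qed
  ultimately show thesis using that v V by blast
qed

text \<open>A linear substitute for the Cauchy--Schwarz inequality: \<open>x \<le> r + x\<^sup>2 / r\<close> for \<open>r > 0\<close>, integrated
  over the speed.\<close>

lemma h1_displacement_le:
  fixes Z :: "real \<Rightarrow> 'a::euclidean_space"
  assumes g: "has_h1_deriv T Z g" and r: "0 < r" and t: "t \<in> {0..T}"
  shows "norm (Z t - Z 0) \<le> r * T + (LINT s|lebesgue_upto T. (norm (g s))\<^sup>2) / r"
proof -
  interpret finite_measure "lebesgue_upto T" by (rule finite_measure_lebesgue_upto)
  have g2: "integrable (lebesgue_upto T) (\<lambda>s. (norm (g s))\<^sup>2)" using g by (simp add: has_h1_deriv_iff)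
  have young: "x \<le> r + x\<^sup>2 / r" for x :: real
  proof (cases "x \<le> r")
    case False
    then have "x * r \<le> x\<^sup>2" using r by (simp add: power2_eq_square)
    then have "x \<le> x\<^sup>2 / r" using r by (simp add: pos_le_divide_eq)
    then show ?thesis using r by simp
  qed (use r in \<open>simp add: add_increasing2\<close>)
  have "norm (Z t - Z 0) = norm (LINT s|lebesgue_upto T. indicator {..t} s *\<^sub>R g s)"
    using h1_primitive[OF g t] by (metis add_diff_cancel_left')
  also have "\<dots> \<le> (LINT s|lebesgue_upto T. norm (indicator {..t} s *\<^sub>R g s))"
    by (rule integral_norm_bound)
  also have "\<dots> \<le> (LINT s|lebesgue_upto T. r + (norm (g s))\<^sup>2 / r)"
  proof (rule Bochner_Integration.integral_mono)
    show "integrable (lebesgue_upto T) (\<lambda>s. norm (indicator {..t} s *\<^sub>R g s))"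
      by (intro integrable_norm integrable_indicator_upto integrable_h1_deriv[OF g]) simp
    show "norm (indicator {..t} s *\<^sub>R g s) \<le> r + (norm (g s))\<^sup>2 / r" for s
      using young[of "norm (g s)"] norm_ge_zero[of "g s"]
      by (cases "s \<le> t") (use r in \<open>simp_all add: less_imp_le\<close>)
  qed (use g2 in simp)
  also have "\<dots> = r * T + (LINT s|lebesgue_upto T. (norm (g s))\<^sup>2) / r"
    using g2 t by (simp add: measure_restrict_space space_restrict_space)
  finally show ?thesis .
qed

text \<open>Two consequences of small energy \<open>E\<close> contradict an interval of length \<open>T / 3\<close> without collapse.
  The deviation stays below \<open>c / 2\<close>, which needs \<open>E \<le> c\<^sup>2 / (64 T)\<close>; then the deviation cost on the
  interval is at least \<open>c\<^sup>2 / 4\<close>, so that \<open>E \<ge> c\<^sup>2 T / 12\<close>. The constant \<open>D\<close> collects the two upper bounds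
  imposed on \<open>E\<close>.\<close>

lemma collapse_in_every_third:
  fixes A :: "real ^ 'n::finite"
  assumes inj: "inj (($) A)" and T: "0 < T"
  obtains e where "0 < e"
    "\<And>P Q Z a b. global_minimizer A T P Q Z \<Longrightarrow> norm (dev P) < e \<Longrightarrow> norm (dev Q) < e \<Longrightarrow>
      0 \<le> a \<Longrightarrow> b \<le> T \<Longrightarrow> b - a = T / 3 \<Longrightarrow> \<exists>t\<in>{a..b}. all_equal (Z t)"
proof -
  interpret finite_measure "lebesgue_upto T" by (rule finite_measure_lebesgue_upto)
  obtain c K where c: "0 < c"
    "\<And>X. \<not> all_equal X \<Longrightarrow> c \<le> norm (dev (ext_gradient (max_corr A) X))"
    and K: "\<And>X. norm (dev (ext_gradient (max_corr A) X)) \<le> K"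
    using dev_ext_gradient_bounds[OF inj] by blast
  define C where "C = 1 + (1 + K)\<^sup>2"
  have C: "0 < C" by (simp add: C_def add_pos_nonneg)
  define D where "D = min (c\<^sup>2 / (64 * T)) (c\<^sup>2 * T / 24)"
  have D: "0 < D" using c T by (simp add: D_def)
  define e where "e = min (min 1 (T / 3)) (min (c / 8) (D / (2 * C)))"
  have e: "0 < e" "e \<le> 1" "2 * e < T" "e \<le> c / 8"
    using c T C D by (auto simp: e_def)
  have eC: "2 * e * C \<le> D"
  proof -
    have "e \<le> D / (2 * C)" by (simp add: e_def)
    then show ?thesis using C by (simp add: pos_le_divide_eq mult_ac)
  qed
  have "\<exists>t\<in>{a..b}. all_equal (Z t)"
    if min: "global_minimizer A T P Q Z" and P: "norm (dev P) < e" and Q: "norm (dev Q) < e"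
      and ab: "0 \<le> a" "b \<le> T" "b - a = T / 3" for P Q Z a b
  proof (rule ccontr)
    assume "\<not> (\<exists>t\<in>{a..b}. all_equal (Z t))"
    then have neq: "\<And>t. t \<in> {a..b} \<Longrightarrow> \<not> all_equal (Z t)" by blast
    note Z = global_minimizerD[OF T min]
    obtain z where z: "has_h1_deriv T Z z" using Z(2) by (auto simp: in_h1_def)
    have dev_ends: "norm (dev (Z 0)) < e" "norm (dev (Z T)) < e"
      using norm_dev_perm_orbit(2)[OF Z(3)] norm_dev_perm_orbit(2)[OF Z(4)] P Q by auto
    obtain V v where V: "has_h1_deriv T V v" "continuous_on {0..T} V"
      "V 0 = dev (Z 0)" "V T = dev (Z T)" "dev_energy A T V v \<le> 2 * e * C"
      using cheap_collapse[OF K e(1-3), of "Z 0" "Z T"] dev_ends unfolding C_def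
      by (metis less_imp_le)
    have "dev_energy A T Z z \<le> dev_energy A T V v"
      by (rule dev_energy_minimal[OF T min z V(1,2)]) (simp_all add: V(3,4))
    with V(5) eC have E: "dev_energy A T Z z \<le> D" by linarith
    have dz: "has_h1_deriv T (\<lambda>t. dev (Z t)) (\<lambda>t. dev (z t))"
      by (rule has_h1_deriv_linear[OF linear_dev z])
    have "(LINT s|lebesgue_upto T. (norm (dev (z s)))\<^sup>2) \<le> dev_energy A T Z z"
      unfolding dev_energy_def
      using dz integrable_dev_cost[OF z Z(1)]
      by (intro Bochner_Integration.integral_mono) (auto simp: dev_cost_def has_h1_deriv_iff)
    with E have kin: "(LINT s|lebesgue_upto T. (norm (dev (z s)))\<^sup>2) \<le> c\<^sup>2 / (64 * T)"
      by (simp add: D_def)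
    have small: "norm (dev (Z t)) \<le> c / 2" if t: "t \<in> {0..T}" for t
    proof -
      \<comment> \<open>The choice \<open>r = c / (8 T)\<close> makes each of the two terms at most \<open>c / 8\<close>.\<close>
      have "norm (dev (Z t) - dev (Z 0)) \<le>
          c / (8 * T) * T + (LINT s|lebesgue_upto T. (norm (dev (z s)))\<^sup>2) / (c / (8 * T))"
        using c T by (intro h1_displacement_le[OF dz _ t]) simp
      also have "\<dots> \<le> c / (8 * T) * T + (c\<^sup>2 / (64 * T)) / (c / (8 * T))"
        using c T kin by (intro add_left_mono divide_right_mono) auto
      also have "\<dots> = c / 4" using c T by (simp add: field_simps power2_eq_square)
      finally show ?thesis
        using norm_triangle_sub[of "dev (Z t)" "dev (Z 0)"] dev_ends(1) e(4) c(1) by linarith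
    qed
    have "c\<^sup>2 / 4 * indicator {a..b} t \<le> dev_cost A (Z t) (z t)" if t: "t \<in> {0..T}" for t
    proof (cases "t \<in> {a..b}")
      case True
      have "c / 2 \<le> norm (dev (Z t - ext_gradient (max_corr A) (Z t)))"
        using c(2)[OF neq[OF True]] small[OF t]
          norm_triangle_sub[of "dev (ext_gradient (max_corr A) (Z t))" "dev (Z t)"]
        by (simp add: linear_diff[OF linear_dev] norm_minus_commute)
      then have "(c / 2)\<^sup>2 \<le> (norm (dev (Z t - ext_gradient (max_corr A) (Z t))))\<^sup>2"
        using c(1) by (intro power_mono) auto
      then have "c\<^sup>2 / 4 \<le> dev_cost A (Z t) (z t)"
        by (simp add: dev_cost_def power_divide add_increasing)
      then show ?thesis using True by simp
    qed simp
    moreover have "integrable (lebesgue_upto T) (\<lambda>t. c\<^sup>2 / 4 * indicator {a..b} t :: real)"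
      using integrable_indicator_upto[OF integrable_const[of "c\<^sup>2 / 4"], of "{a..b}"]
      by (simp add: mult.commute)
    ultimately have "(LINT t|lebesgue_upto T. c\<^sup>2 / 4 * indicator {a..b} t) \<le> dev_energy A T Z z"
      unfolding dev_energy_def using integrable_dev_cost[OF z Z(1)]
      by (intro Bochner_Integration.integral_mono) (auto simp: space_restrict_space)
    moreover have "(LINT t|lebesgue_upto T. c\<^sup>2 / 4 * indicator {a..b} t) = c\<^sup>2 / 4 * (T / 3)"
      using integral_indicator_upto[of a b T] ab T by (subst integral_mult_right_zero) simp
    ultimately have "c\<^sup>2 / 4 * (T / 3) \<le> dev_energy A T Z z" by (simp only:)
    moreover have "dev_energy A T Z z \<le> c\<^sup>2 * T / 24"
      using E by (simp add: D_def)
    ultimately have "c\<^sup>2 / 4 * (T / 3) \<le> c\<^sup>2 * T / 24" by (rule order_trans)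
    moreover have "0 < c\<^sup>2 * T" using c T by simp
    ultimately show False by (simp add: mult.commute)
  qed
  then show thesis using that e(1) by blast
qed

theorem proposition14:
  fixes A :: "real ^ 'n::{finite,linorder}" and T :: real
  assumes A_increasing: "\<And>i j. i < j \<Longrightarrow> A $ i < A $ j"
    and T_pos: "T > 0"
  shows "(\<forall>P Q Z t\<^sub>1 t\<^sub>2.
            global_minimizer A T P Q Z \<longrightarrow> 0 \<le> t\<^sub>1 \<longrightarrow> t\<^sub>1 < t\<^sub>2 \<longrightarrow> t\<^sub>2 \<le> T \<longrightarrow>
            all_equal (Z t\<^sub>1) \<longrightarrow> all_equal (Z t\<^sub>2) \<longrightarrow>
            (\<forall>t\<in>{t\<^sub>1..t\<^sub>2}. all_equal (Z t)))
       \<and> neighbourhood_of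
           {(P, Q). \<forall>Z. global_minimizer A T P Q Z \<longrightarrow>
                        nontrivial_interval {t \<in> {0..T}. all_equal (Z t)}}
           {(P, Q). all_equal P \<and> all_equal Q}"
proof (intro conjI allI impI ballI)
  show "all_equal (Z t)"
    if "global_minimizer A T P Q Z" "0 \<le> t\<^sub>1" "t\<^sub>1 < t\<^sub>2" "t\<^sub>2 \<le> T"
      "all_equal (Z t\<^sub>1)" "all_equal (Z t\<^sub>2)" "t \<in> {t\<^sub>1..t\<^sub>2}" for P Q Z t\<^sub>1 t\<^sub>2 t
    using all_equal_between[OF T_pos that(1-7)] .
  have inj: "inj (($) A)"
    by (rule injI) (metis A_increasing less_irrefl linorder_less_linear)
  obtain e where e: "0 < e"
    "\<And>P Q Z a b. global_minimizer A T P Q Z \<Longrightarrow> norm (dev P) < e \<Longrightarrow> norm (dev Q) < e \<Longrightarrow>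
      0 \<le> a \<Longrightarrow> b \<le> T \<Longrightarrow> b - a = T / 3 \<Longrightarrow> \<exists>t\<in>{a..b}. all_equal (Z t)"
    using collapse_in_every_third[OF inj T_pos] by blast
  let ?W = "{x :: (real, 'n) vec \<times> (real, 'n) vec. norm (dev (fst x)) < e \<and> norm (dev (snd x)) < e}"
  have "open ?W"
    by (intro open_Collect_conj open_Collect_less continuous_on_norm continuous_on_const
        linear_continuous_on_compose[OF _ linear_dev] continuous_on_fst continuous_on_snd
        continuous_on_id)
  moreover have "{(P, Q). all_equal P \<and> all_equal Q} \<subseteq> ?W"
    using e(1) by (auto simp: dev_eq_0_iff[symmetric])
  moreover have "nontrivial_interval {t \<in> {0..T}. all_equal (Z t)}"
    if min: "global_minimizer A T P Q Z" and PQ: "norm (dev P) < e" "norm (dev Q) < e" for P Q Z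
  proof -
    obtain s where s: "s \<in> {0..T / 3}" "all_equal (Z s)"
      using e(2)[OF min PQ, of 0 "T / 3"] T_pos by auto
    obtain t where t: "t \<in> {2 * T / 3..T}" "all_equal (Z t)"
      using e(2)[OF min PQ, of "2 * T / 3" T] T_pos by auto
    have "s < t" "s \<in> {0..T}" "t \<in> {0..T}" using s(1) t(1) T_pos by auto
    moreover have "is_interval {t \<in> {0..T}. all_equal (Z t)}"
      unfolding is_interval_1
    proof (intro ballI allI impI)
      fix a b x assume ab: "a \<in> {t \<in> {0..T}. all_equal (Z t)}" "b \<in> {t \<in> {0..T}. all_equal (Z t)}"
        and x: "a \<le> x \<and> x \<le> b"
      show "x \<in> {t \<in> {0..T}. all_equal (Z t)}"
      proof (cases "a < b")
        case True
        then show ?thesis using ab x all_equal_between[OF T_pos min, of a b x] by auto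
      next
        case False
        then have "x = a" using x by simp
        then show ?thesis using ab(1) by simp
      qed
    qed
    ultimately show ?thesis
      using s(2) t(2) unfolding nontrivial_interval_def by blast
  qed
  ultimately show "neighbourhood_of
      {(P, Q). \<forall>Z. global_minimizer A T P Q Z \<longrightarrow>
        nontrivial_interval {t \<in> {0..T}. all_equal (Z t)}}
      {(P, Q). all_equal P \<and> all_equal Q}"
    unfolding neighbourhood_of_def by (intro exI[of _ ?W]) auto
qed

end
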